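(* Let $q=p^e>4$, where $p$ is a prime, and let $\ell$ be a positive integer with $2\ell\mid e$. Let $\boldsymbol a=(a_1,\ldots,a_n)$ be a vector listing (without repetition) the elements of one of the evaluation sets (R1)--(R10) described in the context, and let $k,h$ be integers satisfying the corresponding conditions, namely: - for (R1), (R3), (R5): $4\le k\le\left\lfloor\frac{n+p^\ell}{p^\ell+1}\right\rfloor$ and $0\le h\le k-4$; - for (R2), (R4), (R6), (R7), (R8), (R10): $4\le k\le\left\lfloor\frac{n+p^\ell-1}{p^\ell+1}\right\rfloor$ and $0\le h\le k-3$; - for (R9): either $4\le k\le\left\lfloor\frac{n+p^\ell}{p^\ell+1}\right\rfloor$ and $0\le h\le k-4$, or $4\le k\le\left\lfloor\frac{n+p^\ell-m}{p^\ell+1}\right\rfloor$ and $0\le h\le k-3$. Let $A_3\in\operatorname{GL}_3(\mathbb F_q)$. If $A_3$ satisfies the MDS conditions (M1), (M2) of the context with respect to $\boldsymbol a$ and $k$, then there exists an $[n+3,k,n-k+4]_q$ MDS generalized Roth-Lempel code $C$ with $\dim(\operatorname{Hull}_\ell(C))=h$. If $A_3$ satisfies the AMDS conditions (N1), (N2) of the context with respect to $\boldsymbol a$ and $k$, then there exists an $[n+3,k,n-k+3]_q$ AMDS generalized Roth-Lempel code $C$ with $\dim(\operatorname{Hull}_\ell(C))=h$.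
   Context: For $0\le\ell\le e-1$, the $\ell$-Galois inner product on $\mathbb F_q^N$ is $\langle\boldsymbol x,\boldsymbol y\rangle_\ell=\sum_i x_iy_i^{p^\ell}$; $C^{\perp_\ell}=\{\boldsymbol x:\langle\boldsymbol c,\boldsymbol x\rangle_\ell=0\ \forall\boldsymbol c\in C\}$ and $\operatorname{Hull}_\ell(C)=C\cap C^{\perp_\ell}$. An $[N,k,d]_q$ code is a $k$-dimensional subspace of $\mathbb F_q^N$ with minimum Hamming distance $d$; it is MDS if $d=N-k+1$ and AMDS if $d=N-k$. Generalized Roth-Lempel (GRL) code: for $1\le s\le k\le n$, $\boldsymbol a\in\mathbb F_q^n$ with distinct entries, $\boldsymbol v\in(\mathbb F_q^* )^n$, $A_s\in\operatorname{GL}_s(\mathbb F_q)$, $$\operatorname{GRL}_k(\boldsymbol a,\boldsymbol v,A_s)=\{(v_1f(a_1),\ldots,v_nf(a_n),(f_{k-s},\ldots,f_{k-1})A_s): f=\textstyle\sum_{j=0}^{k-1}f_jx^j\in\mathbb F_q[x]\},$$ an $[n+s,k]_q$ code. Distance conditions. Write $A_3=(\boldsymbol a_1,\boldsymbol a_2,\boldsymbol a_3)$ by columns (bold $\boldsymbol a_r\in\mathbb F_q^3$ are columns of $A_3$, not entries of $\boldsymbol a$). For $S\subseteq\{1,\ldots,n\}$ put $e_1(S)=\sum_{i\in S}a_i$, $e_2(S)=\sum_{i,j\in S,\,i<j}a_ia_j$. Below, $I,J\subseteq\{1,\ldots,n\}$ always satisfy $|I|=k-2$, $|J|=k-1$,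 and $\boldsymbol\omega_I=(1,e_1(I),e_1(I)^2-e_2(I))^T$, $\boldsymbol\gamma_J=(e_2(J),-e_1(J),1)^T$. (M1) $\det(\boldsymbol a_r,\boldsymbol a_t,\boldsymbol\omega_I)\ne0$ for every $I$ and all $1\le r<t\le3$; (M2) $\boldsymbol a_r^T\boldsymbol\gamma_J\ne0$ for every $J$ and all $1\le r\le3$. (N1) $\det(\boldsymbol a_r,\boldsymbol a_t,\boldsymbol\omega_I)=0$ for some $I$ and some $1\le r<t\le3$, or $\boldsymbol a_r^T\boldsymbol\gamma_J=0$ for some $J$ and some $1\le r\le3$; (N2) for every $J$, at most one of $\boldsymbol a_1^T\boldsymbol\gamma_J,\boldsymbol a_2^T\boldsymbol\gamma_J,\boldsymbol a_3^T\boldsymbol\gamma_J$ is zero. Evaluation sets ($n$ denotes the number of elements; $\omega$ is a primitive element of $\mathbb F_q$): (R1) $n=t\frac{q-1}{p^\ell-1}$, $1\le t\le p^\ell-1$: $\{x\in\mathbb F_q^*:x^{(q-1)/(p^\ell-1)}\in\{b_1,\ldots,b_t\}\}$ for distinct $b_1,\ldots,b_t\in\mathbb F_{p^\ell}^*$. (R2) $n=t\frac{q-1}{p^\ell-1}+1$: a set (R1) together with $0$. (R3) $n=r_1r_2$: let $x_1,x_2$ be positive integers with $(q-1)\mid\operatorname{lcm}(x_1,x_2)$ and $\frac{q-1}{p^\ell-1}\mid x_1$, $\xi_1=\omega^{x_1}$, $\xi_2=\omega^{x_2}$, $r_2=\frac{q-1}{\gcd(x_2,q-1)}$, $1\le r_1\le\frac{q-1}{\gcd(x_1,q-1)}$;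 the set is $\{\xi_1^j\xi_2^v:1\le j\le r_1,1\le v\le r_2\}$. (R4) $n=r_1r_2+1$: a set (R3) together with $0$. (R5) $n=rm$: let $y=\frac{q-1}{p^\ell-1}$, $m\mid(q-1)$, $m_2=\gcd(m,y)$, $m_1=m/m_2$, $H=\langle\omega^{(q-1)/m}\rangle$, $G=\langle\omega^{y/m_2}\rangle$ (so $H\le G$ and $|G/H|=\frac{p^\ell-1}{m_1}$), $1\le r\le\frac{p^\ell-1}{m_1}$; the set is a union of $r$ distinct cosets of $H$ in $G$. (R6) $n=rm+1$: a set (R5) together with $0$. (R7) $n=tp^{e-\ell}$: let $B\subseteq\mathbb F_{p^\ell}$ be an $\mathbb F_p$-subspace, $1\le t\le|B|$, $b_1=0,b_2,\ldots,b_t\in B$ distinct; the set is $\{x\in\mathbb F_q:\operatorname{Tr}(x)\in\{b_1,\ldots,b_t\}\}$, where $\operatorname{Tr}(x)=x+x^{p^\ell}+\cdots+x^{p^{e-\ell}}$ is the trace $\mathbb F_q\to\mathbb F_{p^\ell}$. (R8) $n=tp^r$: let $V$ be an $r$-dimensional $\mathbb F_p$-subspace of $\mathbb F_q$, $L_V(x)=\prod_{v\in V}(x-v)$, and let $b_1,\ldots,b_t$ ($t\ge1$) be distinct elements of $L_V(\mathbb F_q)\cap\mathbb F_{p^\ell}$; the set is $\{x\in\mathbb F_q:L_V(x)\in\{b_1,\ldots,b_t\}\}$. (R9) $n=tmp^r$: let $V$ be an $r$-dimensional $\mathbb F_p$-subspace of $\mathbb F_{p^\ell}$, $0\le r<\ell$,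 $m\mid\frac{q-1}{p^\ell-1}$, $L_V(x)=\prod_{v\in V}(x-v)$, $\Phi(x)=L_V(x^m)$, and let $b_1,\ldots,b_t$ be distinct elements of $L_V(\mathbb F_{p^\ell})\setminus\{0\}$, $1\le t\le p^{\ell-r}-1$; the set is $\{x\in\mathbb F_q:\Phi(x)\in\{b_1,\ldots,b_t\}\}$. (R10) $n=1+m(tp^r-1)$: with $V,m,\Phi$ as in (R9), let $b_1=0,b_2,\ldots,b_t$ be distinct elements of $L_V(\mathbb F_{p^\ell})$, $1\le t\le p^{\ell-r}$; the set is $\{x\in\mathbb F_q:\Phi(x)\in\{b_1,\ldots,b_t\}\}$. *)

theory Defs
  imports
    "Jordan_Normal_Form.VS_Connect"
    "HOL-Algebra.Embedded_Algebras"
    "HOL-Computational_Algebra.Primes"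
    "HOL-Library.Cardinality"
begin

text \<open>
  The field \<open>\<F>\<^sub>q\<close> is a type \<open>'a :: {field, finite}\<close> with \<open>q = CARD('a)\<close>. Vectors over it are
  vectors of the library, so coordinates, and the indices of the evaluation points and of the
  columns of a matrix, start at 0.
\<close>

section \<open>Codes\<close>

definition hamming_dist :: "'a vec \<Rightarrow> 'a vec \<Rightarrow> nat" where
  "hamming_dist x y = card {i. i < dim_vec x \<and> x $ i \<noteq> y $ i}"

definition min_distance :: "'a vec set \<Rightarrow> nat" where
  "min_distance C = Min {hamming_dist x y | x y. x \<in> C \<and> y \<in> C \<and> x \<noteq> y}"

definition linear_code :: "nat \<Rightarrow> 'a::field vec set \<Rightarrow> bool" where
  "linear_code N C \<longleftrightarrow> VectorSpace.subspace class_ring C (module_vec TYPE('a) N)"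

definition code_dim :: "nat \<Rightarrow> 'a::field vec set \<Rightarrow> nat" where
  "code_dim N C = vectorspace.dim class_ring ((module_vec TYPE('a) N)\<lparr>carrier := C\<rparr>)"

text \<open>\<open>C\<close> is an \<open>[N, k, d]\<^sub>q\<close> code.\<close>

definition is_code :: "nat \<Rightarrow> nat \<Rightarrow> nat \<Rightarrow> 'a::field vec set \<Rightarrow> bool" where
  "is_code N k d C \<longleftrightarrow> linear_code N C \<and> code_dim N C = k \<and> min_distance C = d"

text \<open>The defects are written additively, to avoid truncated subtraction.\<close>

definition is_MDS :: "nat \<Rightarrow> 'a::field vec set \<Rightarrow> bool" where
  "is_MDS N C \<longleftrightarrow> (\<exists>k d. is_code N k d C \<and> d + k = N + 1)"

definition is_AMDS :: "nat \<Rightarrow> 'a::field vec set \<Rightarrow> bool" where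
  "is_AMDS N C \<longleftrightarrow> (\<exists>k d. is_code N k d C \<and> d + k = N)"

definition galois_inner :: "nat \<Rightarrow> nat \<Rightarrow> 'a::field vec \<Rightarrow> 'a vec \<Rightarrow> 'a" where
  "galois_inner p l x y = (\<Sum>i<dim_vec x. x $ i * (y $ i) ^ (p ^ l))"

definition galois_dual :: "nat \<Rightarrow> nat \<Rightarrow> nat \<Rightarrow> 'a::field vec set \<Rightarrow> 'a vec set" where
  "galois_dual p l N C = {x \<in> carrier_vec N. \<forall>c\<in>C. galois_inner p l c x = 0}"

definition galois_hull :: "nat \<Rightarrow> nat \<Rightarrow> nat \<Rightarrow> 'a::field vec set \<Rightarrow> 'a vec set" where
  "galois_hull p l N C = C \<inter> galois_dual p l N C"

section \<open>Generalized Roth-Lempel codes\<close>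

definition GRL_params :: "nat \<Rightarrow> nat \<Rightarrow> 'a::field vec \<Rightarrow> 'a vec \<Rightarrow> 'a mat \<Rightarrow> bool" where
  "GRL_params k s a v A \<longleftrightarrow>
     1 \<le> s \<and> s \<le> k \<and> k \<le> dim_vec a \<and> distinct (list_of_vec a) \<and>
     dim_vec v = dim_vec a \<and> (\<forall>i<dim_vec v. v $ i \<noteq> 0) \<and>
     A \<in> carrier_mat s s \<and> invertible_mat A"

text \<open>
  Entry \<open>j\<close> of the row vector \<open>(f\<^bsub>k-s\<^esub>, \<dots>, f\<^bsub>k-1\<^esub>) A\<close> is the scalar product with column \<open>j\<close> of \<open>A\<close>.
\<close>

definition GRL_word :: "nat \<Rightarrow> nat \<Rightarrow> 'a::field vec \<Rightarrow> 'a vec \<Rightarrow> 'a mat \<Rightarrow> 'a poly \<Rightarrow> 'a vec" where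
  "GRL_word k s a v A f =
     vec (dim_vec a) (\<lambda>i. v $ i * poly f (a $ i)) @\<^sub>v
     vec s (\<lambda>j. vec s (\<lambda>i. Polynomial.coeff f (k - s + i)) \<bullet> col A j)"

text \<open>The zero polynomial has degree 0, so for \<open>k \<ge> 1\<close> it is included.\<close>

definition GRL_code :: "nat \<Rightarrow> nat \<Rightarrow> 'a::field vec \<Rightarrow> 'a vec \<Rightarrow> 'a mat \<Rightarrow> 'a vec set" where
  "GRL_code k s a v A = {GRL_word k s a v A f | f. Polynomial.degree f < k}"

section \<open>Distance conditions\<close>

definition esym1 :: "'a::field vec \<Rightarrow> nat set \<Rightarrow> 'a" where
  "esym1 a S = (\<Sum>i\<in>S. a $ i)"

definition esym2 :: "'a::field vec \<Rightarrow> nat set \<Rightarrow> 'a" where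
  "esym2 a S = (\<Sum>(i, j)\<in>{(i, j). i \<in> S \<and> j \<in> S \<and> i < j}. a $ i * a $ j)"

definition omega_vec :: "'a::field vec \<Rightarrow> nat set \<Rightarrow> 'a vec" where
  "omega_vec a S = vec_of_list [1, esym1 a S, (esym1 a S)\<^sup>2 - esym2 a S]"

definition gamma_vec :: "'a::field vec \<Rightarrow> nat set \<Rightarrow> 'a vec" where
  "gamma_vec a S = vec_of_list [esym2 a S, - esym1 a S, 1]"

definition index_sets :: "'a vec \<Rightarrow> nat \<Rightarrow> nat set set" where
  "index_sets a c = {S. S \<subseteq> {..<dim_vec a} \<and> card S = c}"

definition pair_det :: "'a::field vec \<Rightarrow> 'a mat \<Rightarrow> nat \<Rightarrow> nat \<Rightarrow> nat set \<Rightarrow> 'a" where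
  "pair_det a A r t S = det (mat_of_cols 3 [col A r, col A t, omega_vec a S])"

definition cond_M1 :: "'a::field vec \<Rightarrow> nat \<Rightarrow> 'a mat \<Rightarrow> bool" where
  "cond_M1 a k A \<longleftrightarrow>
     (\<forall>I \<in> index_sets a (k - 2). \<forall>r t. r < t \<and> t < 3 \<longrightarrow> pair_det a A r t I \<noteq> 0)"

definition cond_M2 :: "'a::field vec \<Rightarrow> nat \<Rightarrow> 'a mat \<Rightarrow> bool" where
  "cond_M2 a k A \<longleftrightarrow>
     (\<forall>J \<in> index_sets a (k - 1). \<forall>r<3. col A r \<bullet> gamma_vec a J \<noteq> 0)"

definition cond_N1 :: "'a::field vec \<Rightarrow> nat \<Rightarrow> 'a mat \<Rightarrow> bool" where
  "cond_N1 a k A \<longleftrightarrow>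
     (\<exists>I \<in> index_sets a (k - 2). \<exists>r t. r < t \<and> t < 3 \<and> pair_det a A r t I = 0) \<or>
     (\<exists>J \<in> index_sets a (k - 1). \<exists>r<3. col A r \<bullet> gamma_vec a J = 0)"

definition cond_N2 :: "'a::field vec \<Rightarrow> nat \<Rightarrow> 'a mat \<Rightarrow> bool" where
  "cond_N2 a k A \<longleftrightarrow>
     (\<forall>J \<in> index_sets a (k - 1). card {r. r < 3 \<and> col A r \<bullet> gamma_vec a J = 0} \<le> 1)"

section \<open>Evaluation sets\<close>

text \<open>
  For \<open>l\<close> dividing \<open>e\<close>, the subfield of order \<open>p\<^sup>l\<close> of the field of order \<open>p\<^sup>e\<close> is the fixed field of
  the \<open>l\<close>-th power of the Frobenius automorphism.
\<close>

definition subfield_GF :: "nat \<Rightarrow> nat \<Rightarrow> 'a::field set" where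
  "subfield_GF p l = {x. x ^ (p ^ l) = x}"

definition Fp_subspace :: "nat \<Rightarrow> nat \<Rightarrow> 'a::field set \<Rightarrow> bool" where
  "Fp_subspace p r V \<longleftrightarrow> ring.dimension class_ring r (subfield_GF p 1) V"

definition primitive_element :: "'a::field \<Rightarrow> bool" where
  "primitive_element w \<longleftrightarrow> w \<noteq> 0 \<and> (\<forall>x. x \<noteq> 0 \<longrightarrow> (\<exists>i::nat. x = w ^ i))"

text \<open>In a finite field, the powers with exponents in the naturals already form a group.\<close>

definition powers :: "'a::field \<Rightarrow> 'a set" where
  "powers g = range (\<lambda>i::nat. g ^ i)"

definition rel_trace :: "nat \<Rightarrow> nat \<Rightarrow> nat \<Rightarrow> 'a::field \<Rightarrow> 'a" where
  "rel_trace p e l x = (\<Sum>i<e div l. x ^ (p ^ (i * l)))"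

definition L_fun :: "'a::field set \<Rightarrow> 'a \<Rightarrow> 'a" where
  "L_fun V x = (\<Prod>v\<in>V. x - v)"

text \<open>
  Below, \<open>T\<close> is the set of the prescribed values \<open>b\<^sub>1, \<dots>, b\<^sub>t\<close>, so that \<open>card T\<close> is \<open>t\<close>. The
  cardinality of each evaluation set follows from its definition and is not assumed.
\<close>

definition evset_R1 :: "nat \<Rightarrow> nat \<Rightarrow> 'a::{field,finite} set \<Rightarrow> bool" where
  "evset_R1 p l S \<longleftrightarrow>
     (\<exists>T. T \<subseteq> subfield_GF p l - {0} \<and> 1 \<le> card T \<and> card T \<le> p ^ l - 1 \<and>
          S = {x. x \<noteq> 0 \<and> x ^ ((CARD('a) - 1) div (p ^ l - 1)) \<in> T})"

definition evset_R2 :: "nat \<Rightarrow> nat \<Rightarrow> 'a::{field,finite} set \<Rightarrow> bool" where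
  "evset_R2 p l S \<longleftrightarrow> (\<exists>S'. evset_R1 p l S' \<and> S = insert 0 S')"

definition evset_R3 :: "nat \<Rightarrow> nat \<Rightarrow> 'a::{field,finite} \<Rightarrow> 'a set \<Rightarrow> bool" where
  "evset_R3 p l w S \<longleftrightarrow>
     (\<exists>x1 x2 r1 r2. 0 < x1 \<and> 0 < x2 \<and>
        (CARD('a) - 1) dvd lcm x1 x2 \<and> (CARD('a) - 1) div (p ^ l - 1) dvd x1 \<and>
        r2 = (CARD('a) - 1) div gcd x2 (CARD('a) - 1) \<and>
        1 \<le> r1 \<and> r1 \<le> (CARD('a) - 1) div gcd x1 (CARD('a) - 1) \<and>
        S = {(w ^ x1) ^ j * (w ^ x2) ^ v | j v. j \<in> {1..r1} \<and> v \<in> {1..r2}})"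

definition evset_R4 :: "nat \<Rightarrow> nat \<Rightarrow> 'a::{field,finite} \<Rightarrow> 'a set \<Rightarrow> bool" where
  "evset_R4 p l w S \<longleftrightarrow> (\<exists>S'. evset_R3 p l w S' \<and> S = insert 0 S')"

definition evset_R5 :: "nat \<Rightarrow> nat \<Rightarrow> 'a::{field,finite} \<Rightarrow> 'a set \<Rightarrow> bool" where
  "evset_R5 p l w S \<longleftrightarrow>
     (\<exists>m y m1 m2 r H G K. y = (CARD('a) - 1) div (p ^ l - 1) \<and> m dvd CARD('a) - 1 \<and>
        m2 = gcd m y \<and> m1 = m div m2 \<and>
        H = powers (w ^ ((CARD('a) - 1) div m)) \<and> G = powers (w ^ (y div m2)) \<and>
        1 \<le> r \<and> r \<le> (p ^ l - 1) div m1 \<and>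
        K \<subseteq> {(\<lambda>h. g * h) ` H | g. g \<in> G} \<and> card K = r \<and> S = \<Union>K)"

definition evset_R6 :: "nat \<Rightarrow> nat \<Rightarrow> 'a::{field,finite} \<Rightarrow> 'a set \<Rightarrow> bool" where
  "evset_R6 p l w S \<longleftrightarrow> (\<exists>S'. evset_R5 p l w S' \<and> S = insert 0 S')"

definition evset_R7 :: "nat \<Rightarrow> nat \<Rightarrow> nat \<Rightarrow> 'a::{field,finite} set \<Rightarrow> bool" where
  "evset_R7 p e l S \<longleftrightarrow>
     (\<exists>B d T. B \<subseteq> subfield_GF p l \<and> Fp_subspace p d B \<and> T \<subseteq> B \<and> 0 \<in> T \<and>
        1 \<le> card T \<and> card T \<le> card B \<and> S = {x. rel_trace p e l x \<in> T})"

definition evset_R8 :: "nat \<Rightarrow> nat \<Rightarrow> 'a::{field,finite} set \<Rightarrow> bool" where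
  "evset_R8 p l S \<longleftrightarrow>
     (\<exists>V r T. Fp_subspace p r V \<and> T \<subseteq> range (L_fun V) \<inter> subfield_GF p l \<and> 1 \<le> card T \<and>
        S = {x. L_fun V x \<in> T})"

definition evset_R9 :: "nat \<Rightarrow> nat \<Rightarrow> nat \<Rightarrow> 'a::{field,finite} set \<Rightarrow> bool" where
  "evset_R9 p l m S \<longleftrightarrow>
     (\<exists>V r T. V \<subseteq> subfield_GF p l \<and> Fp_subspace p r V \<and> r < l \<and>
        m dvd (CARD('a) - 1) div (p ^ l - 1) \<and>
        T \<subseteq> L_fun V ` subfield_GF p l - {0} \<and> 1 \<le> card T \<and> card T \<le> p ^ (l - r) - 1 \<and>
        S = {x. L_fun V (x ^ m) \<in> T})"

definition evset_R10 :: "nat \<Rightarrow> nat \<Rightarrow> 'a::{field,finite} set \<Rightarrow> bool" where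
  "evset_R10 p l S \<longleftrightarrow>
     (\<exists>V r m T. V \<subseteq> subfield_GF p l \<and> Fp_subspace p r V \<and> r < l \<and>
        m dvd (CARD('a) - 1) div (p ^ l - 1) \<and>
        T \<subseteq> L_fun V ` subfield_GF p l \<and> 0 \<in> T \<and> 1 \<le> card T \<and> card T \<le> p ^ (l - r) \<and>
        S = {x. L_fun V (x ^ m) \<in> T})"

end

theory Submission
  imports Defs "Jordan_Normal_Form.DL_Rank" "HOL-Number_Theory.Residues"
begin

text \<open>
  Put \<open>Q = p ^ l\<close>. The Gram form of the code is the sum over the evaluation points \<open>s\<close> of
  \<open>\<mu> s * f s * g s ^ Q\<close> with \<open>\<mu> = v ^ (Q + 1)\<close>, plus a nondegenerate form in the three leading
  coefficients. Since \<open>2 l\<close> divides \<open>e\<close>, every nonzero element of the subfield of order \<open>Q\<close> is a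
  \<open>(Q + 1)\<close>-st power. For each of the evaluation sets the products \<open>\<Prod>t\<in>S - {s}. s - t\<close> (with \<open>0\<close>
  adjoined to \<open>S\<close>, or not) lie in a single coset of the units of that subfield, so their inverses
  can be taken as \<open>\<mu>\<close>; by Lagrange interpolation the first sum then vanishes, or reduces to a multiple
  of \<open>f 0 * g 0 ^ Q\<close>. Multiplying \<open>v\<close> by a primitive element on \<open>r\<close> evaluation points adds \<open>r\<close> to the
  rank of the form, which gives all the hull dimensions. The minimum distance does not depend on
  \<open>v\<close>: a polynomial with \<open>k - 1\<close> or \<open>k - 2\<close> zeros among the evaluation points is determined up to a
  constant or linear factor, and its three leading coefficients are given by elementary symmetric functions.
\<close>

section \<open>Dimensions of parametrized codes\<close>

text \<open>The ranges of \<open>k\<close> and \<open>h\<close> are read off from one diagonal form.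
  For \<open>f\<close> and \<open>g\<close> of degree below \<open>k\<close>, the product
  \<open>f * g ^ Q\<close> has degree at most \<open>(k - 1) * (Q + 1)\<close>, and the bound on
  \<open>k\<close> keeps this within reach of the interpolation identity. What survives is a sum of
  terms \<open>c z * f z * g z ^ Q\<close> over a finite set \<open>Z\<close>, plus three terms from
  the tail. As \<open>card Z + 3 \<le> k\<close>, the values on \<open>Z\<close> and the tail
  coordinates are independent functionals, so the hull is their common kernel, of dimension
  \<open>k - 3 - card Z\<close>. If a term at \<open>0\<close> survives, \<open>Z\<close> is never
  empty; this is the difference between \<open>h \<le> k - 4\<close> and
  \<open>h \<le> k - 3\<close>. For \<open>evset_R9\<close> the surviving term can be removed by a
  factor \<open>s ^ m\<close> in the weights, at the price of \<open>m\<close> in the degree, which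
  explains the second alternative there. The obstacle is that node products need not lie in the
  subfield. A factor common to all nodes is harmless, since it scales the whole identity; a factor
  depending on \<open>s\<close> is not, and adjoining \<open>0\<close> serves to complete such a
  factor to an element of the subfield.\<close>

lemma code_dim_mult_mat_vec:
  fixes M :: "'a::field mat"
  assumes M: "M \<in> carrier_mat N h"
    and inj: "\<And>x. x \<in> carrier_vec h \<Longrightarrow> M *\<^sub>v x = 0\<^sub>v N \<Longrightarrow> x = 0\<^sub>v h"
  shows "linear_code N {M *\<^sub>v x | x. x \<in> carrier_vec h}"
    and "code_dim N {M *\<^sub>v x | x. x \<in> carrier_vec h} = h"
proof -
  interpret vec_space "TYPE('a)" N .
  \<comment> \<open>The library takes the span of the set of columns, so a repeated column would
    lower the count. Equal columns are excluded by applying \<open>inj\<close> to a difference of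
    unit vectors.\<close>
  have dist: "distinct (cols M)"
  proof (rule ccontr)
    assume "\<not> distinct (cols M)"
    then obtain i j where ij: "i < h" "j < h" "i \<noteq> j" "col M i = col M j"
      using M by (auto simp: distinct_conv_nth)
    have entry: "M $$ (r, i) = M $$ (r, j)" if "r < N" for r
      using arg_cong[OF ij(4), of "\<lambda>u. u $ r"] that ij(1,2) M by simp
    have "M *\<^sub>v (unit_vec h i - unit_vec h j) = 0\<^sub>v N"
      using M ij entry by (subst mult_minus_distrib_mat_vec[OF M])
        (auto simp: mult_mat_vec_def scalar_prod_right_unit intro!: eq_vecI)
    from inj[OF _ this] have "unit_vec h i - unit_vec h j = (0\<^sub>v h :: 'a vec)" by simp
    then have "(unit_vec h i - unit_vec h j) $ i = (0\<^sub>v h :: 'a vec) $ i" by simp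
    then show False using ij by simp
  qed
  have "lin_indpt (set (cols M))"
  proof
    assume "lin_dep (set (cols M))"
    from lin_depE[OF M this dist] inj show False by metis
  qed
  then have r: "rank M = h" using lin_indpt_full_rank[OF M dist] by simp
  have "span (set (cols M)) = {M *\<^sub>v x | x. x \<in> carrier_vec h}"
    using col_space_eq[OF M] M unfolding col_space_def by auto
  moreover have "VectorSpace.subspace class_ring (span (set (cols M))) V"
    using span_is_subspace cols_dim M by blast
  ultimately show "linear_code N {M *\<^sub>v x | x. x \<in> carrier_vec h}"
    "code_dim N {M *\<^sub>v x | x. x \<in> carrier_vec h} = h"
    using r unfolding linear_code_def code_dim_def rank_def by simp_all
qed

text \<open>The domain is described by vanishing coefficients and not by
  \<open>degree f < h\<close>, so that \<open>h = 0\<close> yields the zero space: the zero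
  polynomial has degree \<open>0\<close> and would be lost. The images of the monomials are the
  columns of the matrix to which the previous lemma applies.\<close>

lemma code_dim_image_poly:
  fixes \<phi> :: "'a::field poly \<Rightarrow> 'a vec"
  assumes dim: "\<And>f. \<phi> f \<in> carrier_vec N"
    and add: "\<And>f g. \<phi> (f + g) = \<phi> f + \<phi> g"
    and smult: "\<And>c f. \<phi> (Polynomial.smult c f) = c \<cdot>\<^sub>v \<phi> f"
    and inj: "\<And>f. (\<forall>i\<ge>h. poly.coeff f i = 0) \<Longrightarrow> \<phi> f = 0\<^sub>v N \<Longrightarrow> f = 0"
  shows "linear_code N (\<phi> ` {f. \<forall>i\<ge>h. poly.coeff f i = 0})"
    and "code_dim N (\<phi> ` {f. \<forall>i\<ge>h. poly.coeff f i = 0}) = h"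
proof -
  define M where "M = mat N h (\<lambda>(i,j). \<phi> (Polynomial.monom 1 j) $ i)"
  define P where "P x n = (\<Sum>j<n. Polynomial.monom (x j) j)" for x :: "nat \<Rightarrow> 'a" and n
  have coeffP: "poly.coeff (P x n) i = (if i < n then x i else 0)" for x n i
    unfolding P_def by (simp add: coeff_sum)
  have "0 \<cdot>\<^sub>v \<phi> 0 = 0\<^sub>v N" using dim[of 0] by auto
  then have phi0: "\<phi> 0 = 0\<^sub>v N" using smult[of 0 0] by simp
  have phiP: "\<phi> (P x n) = vec N (\<lambda>i. \<Sum>j<n. x j * \<phi> (Polynomial.monom 1 j) $ i)" for x n
  proof (induction n)
    case 0
    then show ?case by (auto simp: P_def phi0)
  next
    case (Suc n)
    have "\<phi> (Polynomial.monom (x n) n) = x n \<cdot>\<^sub>v \<phi> (Polynomial.monom 1 n)"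
      using smult[of "x n" "Polynomial.monom 1 n"] by (simp add: smult_monom)
    then have "\<phi> (P x (Suc n)) = \<phi> (P x n) + x n \<cdot>\<^sub>v \<phi> (Polynomial.monom 1 n)"
      by (simp add: P_def add)
    then show ?case using dim[of "Polynomial.monom 1 n"]
      by (auto simp: Suc intro!: eq_vecI)
  qed
  have M: "M \<in> carrier_mat N h" by (simp add: M_def)
  have Mx: "M *\<^sub>v x = \<phi> (P (\<lambda>j. x $ j) h)" if "x \<in> carrier_vec h" for x
    using that by (auto simp: phiP M_def scalar_prod_def atLeast0LessThan mult.commute intro!: eq_vecI sum.cong)
  have "x = 0\<^sub>v h" if x: "x \<in> carrier_vec h" "M *\<^sub>v x = 0\<^sub>v N" for x
  proof -
    have "P (\<lambda>j. x $ j) h = 0" using inj[of "P (\<lambda>j. x $ j) h"] x Mx coeffP by auto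
    then have "x $ j = 0" if "j < h" for j using coeffP[of "\<lambda>j. x $ j" h j] that by simp
    then show ?thesis using x by auto
  qed
  note * = code_dim_mult_mat_vec[OF M this]
  have "{M *\<^sub>v x | x. x \<in> carrier_vec h} = \<phi> ` {f. \<forall>i\<ge>h. poly.coeff f i = 0}"
  proof (intro equalityI subsetI)
    fix y assume "y \<in> {M *\<^sub>v x | x. x \<in> carrier_vec h}"
    then show "y \<in> \<phi> ` {f. \<forall>i\<ge>h. poly.coeff f i = 0}" using Mx coeffP by fastforce
  next
    fix y assume "y \<in> \<phi> ` {f. \<forall>i\<ge>h. poly.coeff f i = 0}"
    then obtain f where f: "y = \<phi> f" "\<forall>i\<ge>h. poly.coeff f i = 0" by blast
    have "f = P (\<lambda>j. vec h (poly.coeff f) $ j) h"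
      using f(2) by (intro poly_eqI) (simp add: coeffP)
    with f(1) Mx[of "vec h (poly.coeff f)"] have "y = M *\<^sub>v vec h (poly.coeff f)" by simp
    then show "y \<in> {M *\<^sub>v x | x. x \<in> carrier_vec h}"
      using vec_carrier by blast
  qed
  with * show "linear_code N (\<phi> ` {f. \<forall>i\<ge>h. poly.coeff f i = 0})"
    and "code_dim N (\<phi> ` {f. \<forall>i\<ge>h. poly.coeff f i = 0}) = h" by auto
qed

section \<open>Node polynomials\<close>

lemma degree_prod_linear:
  "finite Z \<Longrightarrow> Polynomial.degree (\<Prod>z\<in>Z. [:- z, 1:] :: 'a::field poly) = card Z"
  by (subst degree_prod_eq_sum_degree) auto

text \<open>Both sides share degree and leading coefficient, so agreement on the
  \<open>card Z\<close> points of \<open>Z\<close> forces equality.\<close>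

lemma poly_eq_prod_linear:
  fixes P :: "'a::field poly"
  assumes "finite Z" "\<And>z. z \<in> Z \<Longrightarrow> poly P z = 0" "Polynomial.degree P = card Z"
  shows "P = Polynomial.smult (lead_coeff P) (\<Prod>z\<in>Z. [:- z, 1:])"
proof (rule poly_eqI_degree_lead_coeff)
  let ?L = "\<Prod>z\<in>Z. [:- z, 1:] :: 'a poly"
  have "lead_coeff ?L = 1" by (simp add: lead_coeff_prod)
  then show "poly.coeff P (card Z) = poly.coeff (Polynomial.smult (lead_coeff P) ?L) (card Z)"
    using assms(1,3) by (simp add: degree_prod_linear)
  show "Polynomial.degree (Polynomial.smult (lead_coeff P) ?L) \<le> card Z"
    using assms(1) degree_smult_le[of "lead_coeff P" ?L] by (simp add: degree_prod_linear)
  show "poly P z = poly (Polynomial.smult (lead_coeff P) ?L) z" if "z \<in> Z" for z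
    using assms(1,2) that by (auto simp: poly_prod)
qed (use assms in auto)

text \<open>Coefficient of \<open>x\<^sup>n\<^sup>-\<^sup>1\<close> in Lagrange's interpolation formula.\<close>

lemma sum_poly_over_node_derivative:
  fixes F :: "'a::field poly"
  assumes S: "finite S" and deg: "Polynomial.degree F + 2 \<le> card S"
  shows "(\<Sum>s\<in>S. poly F s / (\<Prod>t\<in>S - {s}. s - t)) = 0"
proof -
  define L where "L s = (\<Prod>t\<in>S - {s}. [:- t, 1:])" for s :: 'a
  define W where "W s = (\<Prod>t\<in>S - {s}. s - t)" for s :: 'a
  define G where "G = (\<Sum>s\<in>S. Polynomial.smult (poly F s / W s) (L s))"
  have W: "W s \<noteq> 0" for s using S by (simp add: W_def)
  have LW: "poly (L s) s = W s" for s by (simp add: L_def W_def poly_prod)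
  have L0: "poly (L s) t = 0" if "t \<in> S" "t \<noteq> s" for s t
    using that S by (auto simp: L_def poly_prod)
  have dL: "Polynomial.degree (L s) = card S - 1" if "s \<in> S" for s
    using that S by (simp add: L_def degree_prod_linear)
  have lL: "poly.coeff (L s) (card S - 1) = 1" if "s \<in> S" for s
    using dL[OF that] lead_coeff_prod[of "\<lambda>t. [:- t, 1:]" "S - {s}"] by (simp add: L_def)
  have G: "poly G t = poly F t" if "t \<in> S" for t
  proof -
    have "poly G t = (\<Sum>s\<in>S. if s = t then poly F t else 0)"
      unfolding G_def poly_sum by (rule sum.cong) (use that L0 LW W in auto)
    then show ?thesis using that S by simp
  qed
  have "Polynomial.degree G \<le> card S - 1" unfolding G_def
    using dL S by (intro degree_sum_le) (auto intro: order_trans[OF degree_smult_le])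
  moreover have "card S > 0" using deg by simp
  \<comment> \<open>\<open>G\<close> is the Lagrange interpolant of \<open>F\<close> on
    \<open>S\<close>. Both have degree below \<open>card S\<close>, and the coefficient of
    \<open>G\<close> at \<open>card S - 1\<close> is the sum in question.\<close>
  ultimately have "G = F"
    using deg G by (intro poly_eqI_degree[of S]) auto
  then have "poly.coeff G (card S - 1) = 0" using deg by (simp add: coeff_eq_0)
  then show ?thesis using lL unfolding G_def W_def by (simp add: coeff_sum)
qed

text \<open>A fibre of full size \<open>degree P\<close> over \<open>b\<close> has node polynomial \<open>P - b\<close>.\<close>

lemma prod_diff_preimage:
  fixes P :: "'a::{field,finite} poly"
  assumes monic: "lead_coeff P = 1" and deg: "Polynomial.degree P > 0"
    and fib: "\<And>b. b \<in> T \<Longrightarrow> card {x. poly P x = b} = Polynomial.degree P"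
  shows "(\<Prod>s | poly P s \<in> T. c - s) = (\<Prod>b\<in>T. poly P c - b)"
proof -
  have full: "(\<Prod>s\<in>{x. poly P x = b}. c - s) = poly P c - b" if b: "b \<in> T" for b
  proof -
    have "Polynomial.degree (P + [:- b:]) = Polynomial.degree P"
      using deg by (intro degree_add_eq_left) simp
    moreover have eq: "P + [:- b:] = P - [:b:]" by simp
    ultimately have d: "Polynomial.degree (P - [:b:]) = Polynomial.degree P"
      by metis
    then have lc: "lead_coeff (P - [:b:]) = 1"
      using monic deg by (simp add: coeff_pCons split: nat.split)
    have "P - [:b:] = Polynomial.smult (lead_coeff (P - [:b:])) (\<Prod>z\<in>{x. poly P x = b}. [:- z, 1:])"
      by (rule poly_eq_prod_linear) (use fib[OF b] d in auto)
    from arg_cong[OF this, of "\<lambda>p. poly p c"] lc show ?thesis by (simp add: poly_prod)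
  qed
  have "{s. poly P s \<in> T} = (\<Union>b\<in>T. {x. poly P x = b})" by auto
  then have "(\<Prod>s | poly P s \<in> T. c - s) = (\<Prod>b\<in>T. \<Prod>s\<in>{x. poly P x = b}. c - s)"
    by (simp only:) (rule prod.UNION_disjoint, auto)
  also have "\<dots> = (\<Prod>b\<in>T. poly P c - b)"
    using full by (intro prod.cong) auto
  finally show ?thesis .
qed

text \<open>The fibre through \<open>a\<close> contributes its own differences, and every other full
  fibre contributes one difference of values of \<open>P\<close>. When \<open>T\<close> lies in the
  subfield, only the first factor can leave the subfield.\<close>

lemma prod_diff_preimage_remove:
  fixes P :: "'a::{field,finite} poly"
  assumes "lead_coeff P = 1" and "Polynomial.degree P > 0"
    and "\<And>b. b \<in> T \<Longrightarrow> card {x. poly P x = b} = Polynomial.degree P"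
    and a: "poly P a \<in> T"
  shows "(\<Prod>s\<in>{x. poly P x \<in> T} - {a}. a - s) =
    (\<Prod>s\<in>{x. poly P x = poly P a} - {a}. a - s) * (\<Prod>b\<in>T - {poly P a}. poly P a - b)"
proof -
  have "{x. poly P x \<in> T} - {a} =
      ({x. poly P x = poly P a} - {a}) \<union> {x. poly P x \<in> T - {poly P a}}"
    using a by auto
  then have "(\<Prod>s\<in>{x. poly P x \<in> T} - {a}. a - s) =
      (\<Prod>s\<in>{x. poly P x = poly P a} - {a}. a - s) * (\<Prod>s | poly P s \<in> T - {poly P a}. a - s)"
    by (simp only:) (rule prod.union_disjoint, auto)
  also have "(\<Prod>s | poly P s \<in> T - {poly P a}. a - s) = (\<Prod>b\<in>T - {poly P a}. poly P a - b)"
    using assms by (intro prod_diff_preimage) auto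
  finally show ?thesis .
qed

section \<open>Finite fields\<close>

lemma CHAR_eq_prime:
  assumes "prime p" "CARD('a::{field,finite}) = p ^ e"
  shows "CHAR('a) = p"
proof -
  have "prime CHAR('a)"
    using prime_CHAR_semidom[where ?'a = 'a] finite_imp_CHAR_pos[where ?'a = 'a] by simp
  moreover have "CHAR('a) dvd p ^ e" using CHAR_dvd_CARD[where ?'a = 'a] assms(2) by simp
  ultimately show ?thesis using assms(1) prime_dvd_power primes_dvd_imp_eq by blast
qed

lemma finite_field_power_card_minus_1:
  fixes x :: "'a::{field,finite}"
  assumes "x \<noteq> 0"
  shows "x ^ (CARD('a) - 1) = 1"
proof -
  have "(\<Prod>y\<in>UNIV - {0}. x * y) = (\<Prod>y\<in>UNIV - {0}. y)"
    by (rule prod.reindex_bij_witness[of _ "\<lambda>y. y / x" "\<lambda>y. x * y"]) (use assms in auto)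
  then have "x ^ (CARD('a) - 1) * (\<Prod>y\<in>UNIV - {0}. y) = (\<Prod>y\<in>UNIV - {0 :: 'a}. y)"
    by (simp add: prod.distrib card_Diff_singleton)
  then show ?thesis by simp
qed

text \<open>\<open>primitive_element\<close> only says that the powers of \<open>w\<close> exhaust
  the nonzero elements. If \<open>w ^ n = 1\<close> with \<open>0 < n < q - 1\<close>, there would
  be at most \<open>n\<close> distinct powers, which is too few.\<close>

lemma primitive_element_power_eq_1_iff:
  fixes w :: "'a::{field,finite}"
  assumes w: "primitive_element w"
  shows "w ^ n = 1 \<longleftrightarrow> CARD('a) - 1 dvd n"
proof -
  have w0: "w \<noteq> 0" using w by (simp add: primitive_element_def)
  have c: "card (UNIV - {0 :: 'a}) = CARD('a) - 1" by (simp add: card_Diff_singleton)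
  have card2: "CARD('a) \<ge> 2" using card_mono[of UNIV "{0, 1 :: 'a}"] by simp
  have ord: "w ^ (CARD('a) - 1) = 1" using w0 by (rule finite_field_power_card_minus_1)
  have small: "n = 0" if "w ^ n = 1" "n < CARD('a) - 1" for n
  proof (rule ccontr)
    assume n: "n \<noteq> 0"
    have "UNIV - {0} \<subseteq> (\<lambda>i. w ^ i) ` {..<n}"
    proof
      fix x :: 'a assume "x \<in> UNIV - {0}"
      then obtain i where i: "x = w ^ i" using w by (auto simp: primitive_element_def)
      have "w ^ i = w ^ (n * (i div n) + i mod n)" by simp
      also have "\<dots> = w ^ (i mod n)" unfolding power_add power_mult using that by simp
      finally show "x \<in> (\<lambda>i. w ^ i) ` {..<n}" using i n by auto
    qed
    then have "card (UNIV - {0 :: 'a}) \<le> card ((\<lambda>i. w ^ i) ` {..<n})" by (intro card_mono) auto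
    also have "\<dots> \<le> n" using card_image_le[of "{..<n}"] by simp
    finally show False using c that by simp
  qed
  show ?thesis
  proof
    assume "w ^ n = 1"
    have "w ^ n = w ^ ((CARD('a) - 1) * (n div (CARD('a) - 1)) + n mod (CARD('a) - 1))" by simp
    also have "\<dots> = w ^ (n mod (CARD('a) - 1))" unfolding power_add power_mult using ord by simp
    finally have "n mod (CARD('a) - 1) = 0" using \<open>w ^ n = 1\<close> card2 by (intro small) auto
    then show "CARD('a) - 1 dvd n" by auto
  next
    assume "CARD('a) - 1 dvd n"
    then show "w ^ n = 1" using ord by (auto simp: power_mult elim!: dvdE)
  qed
qed

lemma primitive_element_power_eq_iff:
  fixes w :: "'a::{field,finite}"
  assumes w: "primitive_element w" and "i \<le> j"
  shows "w ^ i = w ^ j \<longleftrightarrow> CARD('a) - 1 dvd j - i"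
proof -
  have "w ^ j = w ^ i * w ^ (j - i)" using assms(2) by (simp flip: power_add)
  then show ?thesis using w primitive_element_power_eq_1_iff[OF w, of "j - i"]
    by (simp add: primitive_element_def)
qed

text \<open>The \<open>d\<close> listed powers are pairwise distinct roots, and
  \<open>x ^ d - 1\<close> has no more than \<open>d\<close> roots.\<close>

lemma roots_of_unity_eq:
  fixes w :: "'a::{field,finite}"
  assumes w: "primitive_element w" and d: "d dvd CARD('a) - 1"
  shows "{z. z ^ d = 1} = (\<lambda>i. w ^ ((CARD('a) - 1) div d * i)) ` {..<d}"
    and "card {z :: 'a. z ^ d = 1} = d"
proof -
  have card2: "CARD('a) \<ge> 2" using card_mono[of UNIV "{0, 1 :: 'a}"] by simp
  define m where "m = (CARD('a) - 1) div d"
  have md: "m * d = CARD('a) - 1" using d by (simp add: m_def)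
  have d0: "d > 0" "m > 0" using md card2 by (auto intro!: Nat.gr0I)
  have "inj_on (\<lambda>i. w ^ (m * i)) {..<d}"
  proof (intro linorder_inj_onI' notI)
    fix i j assume ij: "i \<in> {..<d}" "j \<in> {..<d}" "i < j" "w ^ (m * i) = w ^ (m * j)"
    then have "m * d dvd m * (j - i)"
      using primitive_element_power_eq_iff[OF w, of "m * i" "m * j"] by (simp add: md right_diff_distrib')
    then have "d dvd j - i" using d0 by simp
    with ij show False by (auto dest: dvd_imp_le)
  qed
  then have c: "card ((\<lambda>i. w ^ (m * i)) ` {..<d}) = d" by (simp add: card_image)
  have sub: "(\<lambda>i. w ^ (m * i)) ` {..<d} \<subseteq> {z. z ^ d = 1}"
  proof clarify
    fix i
    have "(w ^ (m * i)) ^ d = w ^ ((CARD('a) - 1) * i)"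
      unfolding md[symmetric] by (simp flip: power_mult add: mult_ac)
    then show "(w ^ (m * i)) ^ d = 1" using primitive_element_power_eq_1_iff[OF w] by simp
  qed
  let ?P = "Polynomial.monom 1 d - 1 :: 'a poly"
  have P: "?P \<noteq> 0" using d0 by (auto simp: poly_eq_iff intro!: exI[of _ d])
  have "card {z :: 'a. poly ?P z = 0} \<le> Polynomial.degree ?P" using P by (rule card_poly_roots_bound)
  also have "\<dots> \<le> d" by (intro degree_diff_le) (simp_all add: degree_monom_le)
  finally have "card {z :: 'a. z ^ d = 1} \<le> d" by (simp add: poly_monom)
  with c have "(\<lambda>i. w ^ (m * i)) ` {..<d} = {z. z ^ d = 1}"
    by (intro card_seteq sub) auto
  with c show "{z. z ^ d = 1} = (\<lambda>i. w ^ ((CARD('a) - 1) div d * i)) ` {..<d}"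
    "card {z :: 'a. z ^ d = 1} = d" unfolding m_def[symmetric] by simp_all
qed

lemma power_fibre_eq:
  fixes a :: "'a::field"
  assumes "a \<noteq> 0"
  shows "{x. x ^ d = a ^ d} = (\<lambda>z. a * z) ` {z. z ^ d = 1}"
proof (intro equalityI subsetI)
  fix x assume "x \<in> {x. x ^ d = a ^ d}"
  then have "x = a * (x / a)" "(x / a) ^ d = 1" using assms by (auto simp: power_divide)
  then show "x \<in> (\<lambda>z. a * z) ` {z. z ^ d = 1}" by blast
qed (auto simp: power_mult_distrib)

lemma subfield_GF_0 [simp]: "p > 0 \<Longrightarrow> 0 \<in> subfield_GF p l"
  and subfield_GF_1 [simp]: "1 \<in> subfield_GF p l"
  and subfield_GF_mult: "x \<in> subfield_GF p l \<Longrightarrow> y \<in> subfield_GF p l \<Longrightarrow> x * y \<in> subfield_GF p l"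
  and subfield_GF_inverse: "x \<in> subfield_GF p l \<Longrightarrow> inverse x \<in> subfield_GF p l"
  and subfield_GF_power: "x \<in> subfield_GF p l \<Longrightarrow> x ^ n \<in> subfield_GF p l"
  by (auto simp: subfield_GF_def power_mult_distrib power_inverse simp flip: power_mult)
     (metis mult.commute power_mult)

lemma subfield_GF_prod:
  "(\<And>i. i \<in> I \<Longrightarrow> f i \<in> subfield_GF p l) \<Longrightarrow> prod f I \<in> subfield_GF p l"
  by (induction I rule: infinite_finite_induct) (auto intro: subfield_GF_mult)

lemma frobenius_power_diff:
  fixes x y :: "'a::field"
  assumes "prime p" "CHAR('a) = p"
  shows "(x - y) ^ p ^ l = x ^ p ^ l - y ^ p ^ l"
proof -
  have "((x - y) + y) ^ p ^ l = (x - y) ^ p ^ l + y ^ p ^ l"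
    using assms by (intro freshmans_dream'[of _ l]) auto
  then show ?thesis by simp
qed

lemma subfield_GF_diff:
  fixes x y :: "'a::field"
  assumes "prime p" "CHAR('a) = p" "x \<in> subfield_GF p l" "y \<in> subfield_GF p l"
  shows "x - y \<in> subfield_GF p l"
  using assms by (simp add: subfield_GF_def frobenius_power_diff)

text \<open>The elements are roots of \<open>x ^ Q - x\<close>. This upper bound feeds the count
  that determines the size of the kernel of the trace.\<close>

lemma card_subfield_GF_le:
  assumes "p ^ l > 1"
  shows "card (subfield_GF p l :: 'a::{field,finite} set) \<le> p ^ l"
proof -
  let ?P = "Polynomial.monom 1 (p ^ l) - [:0, 1:] :: 'a poly"
  have "poly.coeff ?P (p ^ l) = 1"
    using assms by (cases "p ^ l" rule: nat.exhaust) (auto simp: coeff_pCons split: nat.split)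
  then have "?P \<noteq> 0" by (metis coeff_0 zero_neq_one)
  then have "card {z :: 'a. poly ?P z = 0} \<le> Polynomial.degree ?P" by (rule card_poly_roots_bound)
  also have "\<dots> \<le> p ^ l" using assms by (intro degree_diff_le) (simp_all add: degree_monom_le)
  finally show ?thesis by (simp add: poly_monom subfield_GF_def)
qed

lemma mem_subfield_GF_iff:
  fixes x :: "'a::field"
  assumes "x \<noteq> 0" "p > 0"
  shows "x \<in> subfield_GF p l \<longleftrightarrow> x ^ (p ^ l - 1) = 1"
proof -
  have "x ^ p ^ l = x ^ (p ^ l - 1) * x"
    using assms(2) by (simp flip: power_Suc2)
  then show ?thesis using assms(1) by (simp add: subfield_GF_def)
qed

lemma power_minus_one_dvd: "(x::nat) - 1 dvd x ^ n - 1"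
proof (cases "x = 0")
  case False
  then show ?thesis
  proof (induction n)
    case (Suc n)
    have "x ^ Suc n - 1 = (x - 1) * x ^ n + (x ^ n - 1)"
      using Suc.prems by (cases x) (auto simp: algebra_simps)
    then show ?case using Suc by (metis dvd_add dvd_triv_left)
  qed simp
qed (cases n; simp)

text \<open>As \<open>2l\<close> divides \<open>e\<close>, the index of the unit group of the subfield is a multiple of \<open>p\<^sup>l + 1\<close>.\<close>

lemma subfield_GF_imp_power:
  fixes w x :: "'a::{field,finite}"
  assumes "prime p" "CARD('a) = p ^ e" "2 * l dvd e" "l > 0" "primitive_element w"
    and x: "x \<in> subfield_GF p l" "x \<noteq> 0"
  shows "\<exists>y. y \<noteq> 0 \<and> y ^ (p ^ l + 1) = x"
proof -
  define Q where "Q = p ^ l"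
  have Q: "Q > 1" unfolding Q_def using assms(1,4) by (intro one_less_power prime_gt_1_nat)
  obtain c where c: "e = 2 * l * c" using assms(3) by blast
  have "Q * Q - 1 dvd (Q * Q) ^ c - 1" by (rule power_minus_one_dvd)
  also have "(Q * Q) ^ c - 1 = CARD('a) - 1"
    by (simp add: assms(2) c Q_def flip: power_add power_mult) (simp add: mult_2)
  also have "Q * Q - 1 = (Q + 1) * (Q - 1)" by (simp add: algebra_simps)
  finally obtain d where d: "CARD('a) - 1 = (Q + 1) * (Q - 1) * d" by blast
  obtain i where i: "x = w ^ i" using assms(5) x by (auto simp: primitive_element_def)
  \<comment> \<open>Membership in the subfield means \<open>x ^ (Q - 1) = 1\<close>. As
    \<open>(Q + 1) * (Q - 1)\<close> divides \<open>q - 1\<close>, this forces \<open>Q + 1\<close>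
    to divide the exponent \<open>i\<close>.\<close>
  have "w ^ (i * (Q - 1)) = 1"
    using x mem_subfield_GF_iff[of x p l] Q i by (simp add: power_mult Q_def prime_gt_0_nat assms(1))
  then have "CARD('a) - 1 dvd i * (Q - 1)" using primitive_element_power_eq_1_iff[OF assms(5)] by simp
  then have "(Q - 1) * ((Q + 1) * d) dvd (Q - 1) * i" unfolding d by (simp only: mult_ac)
  then have "(Q + 1) * d dvd i" using Q by simp
  then obtain j where "i = (Q + 1) * j" by (meson dvd_mult_left dvdE)
  then have "(w ^ j) ^ (Q + 1) = x" using i by (simp only: mult.commute power_mult[symmetric])
  moreover have "w ^ j \<noteq> 0" using assms(5) by (simp add: primitive_element_def)
  ultimately show ?thesis unfolding Q_def by blast
qed

section \<open>Weights for the evaluation sets\<close>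

locale galois_field =
  fixes p e l :: nat and w :: "'a::{field,finite}"
  assumes prime: "prime p" and card: "CARD('a) = p ^ e" and l: "l > 0" and dvd: "2 * l dvd e"
    and prim: "primitive_element w"
begin

lemma char: "CHAR('a) = p"
  using prime card by (rule CHAR_eq_prime)

lemma Q_gt_1: "p ^ l > 1"
  using prime l by (intro one_less_power prime_gt_1_nat)

lemma card_gt_1: "CARD('a) > 1"
  using card_mono[of UNIV "{0, 1 :: 'a}"] by simp

lemma GF_0: "0 \<in> subfield_GF p l"
  using prime by (simp add: prime_gt_0_nat)

lemma GF_diff: "x \<in> subfield_GF p l \<Longrightarrow> y \<in> subfield_GF p l \<Longrightarrow> x - y \<in> subfield_GF p l" for x y :: 'a
  using prime char by (rule subfield_GF_diff)

lemma inj_frobenius: "inj (\<lambda>x :: 'a. x ^ p ^ l)"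
proof (rule injI)
  fix x y :: 'a assume "x ^ p ^ l = y ^ p ^ l"
  then have "(x - y) ^ p ^ l = 0" using frobenius_power_diff[OF prime char] by simp
  then show "x = y" by simp
qed

text \<open>Here \<open>\<mu> s\<close> is the value of \<open>v\<^sub>i ^ (p ^ l + 1)\<close> at the evaluation point \<open>s = a\<^sub>i\<close>, and the polynomial
  \<open>F\<close> stands for \<open>f * g ^ (p ^ l)\<close>. Only \<open>E = {}\<close> and \<open>E = {0}\<close> occur.\<close>

definition galois_weights :: "'a set \<Rightarrow> 'a set \<Rightarrow> nat \<Rightarrow> bool" where
  "galois_weights S E j \<longleftrightarrow> (\<exists>\<mu> c. (\<forall>s\<in>S. \<exists>y. y \<noteq> 0 \<and> y ^ (p ^ l + 1) = \<mu> s) \<and> (\<forall>z\<in>E. c z \<noteq> 0) \<and>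
     (\<forall>F. Polynomial.degree F + j \<le> card S \<longrightarrow>
        (\<Sum>s\<in>S. \<mu> s * poly F s) = (\<Sum>z\<in>E. c z * poly F z)))"

lemma galois_weightsI:
  assumes "\<And>s. s \<in> S \<Longrightarrow> \<mu> s \<in> subfield_GF p l - {0}" and "\<And>z. z \<in> E \<Longrightarrow> c z \<noteq> 0"
    and "\<And>F. Polynomial.degree F + j \<le> card S \<Longrightarrow>
        (\<Sum>s\<in>S. \<mu> s * poly F s) = (\<Sum>z\<in>E. c z * poly F z)"
  shows "galois_weights S E j"
  unfolding galois_weights_def
  using assms subfield_GF_imp_power[OF prime card dvd l prim]
  by (intro exI[of _ \<mu>] exI[of _ c]) blast

text \<open>Scaling all Lagrange weights by one constant preserves the identity, so only the class
  of the node products modulo the units of the subfield matters: after scaling by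
  \<open>\<beta>\<close> each weight is some \<open>inverse u\<close>.\<close>

lemma galois_weights_nodes:
  assumes "\<beta> \<noteq> 0"
    and nodes: "\<And>s. s \<in> S \<Longrightarrow> \<exists>u\<in>subfield_GF p l - {0}. (\<Prod>t\<in>S - {s}. s - t) = \<beta> * u"
  shows "galois_weights S {} 2"
proof (rule galois_weightsI[where \<mu> = "\<lambda>s. \<beta> / (\<Prod>t\<in>S - {s}. s - t)" and c = "\<lambda>_. 1"])
  fix s assume "s \<in> S"
  then obtain u where u: "u \<in> subfield_GF p l - {0}" "(\<Prod>t\<in>S - {s}. s - t) = \<beta> * u"
    using nodes by blast
  then have "\<beta> / (\<Prod>t\<in>S - {s}. s - t) = inverse u" using assms(1) by (simp add: divide_inverse)
  then show "\<beta> / (\<Prod>t\<in>S - {s}. s - t) \<in> subfield_GF p l - {0}"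
    using u subfield_GF_inverse[of u p l] by auto
next
  fix F :: "'a poly" assume "Polynomial.degree F + 2 \<le> card S"
  then have "(\<Sum>s\<in>S. \<beta> * (poly F s / (\<Prod>t\<in>S - {s}. s - t))) = 0"
    unfolding sum_distrib_left[symmetric] by (simp add: sum_poly_over_node_derivative)
  then show "(\<Sum>s\<in>S. \<beta> / (\<Prod>t\<in>S - {s}. s - t) * poly F s) = (\<Sum>z\<in>{}. 1 * poly F z)" by simp
qed auto

text \<open>Interpolation takes place on \<open>insert 0 S\<close>, with one node more than the code
  uses. This raises the admissible degree by one, and the term at the extra node, moved to the other
  side, becomes \<open>c 0\<close>.\<close>

lemma galois_weights_nodes_zero:
  assumes "\<beta> \<noteq> 0" and S0: "0 \<notin> S"
    and nodes: "\<And>s. s \<in> S \<Longrightarrow> \<exists>u\<in>subfield_GF p l - {0}. (\<Prod>t\<in>insert 0 S - {s}. s - t) = \<beta> * u"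
  shows "galois_weights S {0} 1"
proof (rule galois_weightsI[where \<mu> = "\<lambda>s. \<beta> / (\<Prod>t\<in>insert 0 S - {s}. s - t)"
      and c = "\<lambda>_. - \<beta> / (\<Prod>t\<in>S. 0 - t)"])
  fix s assume "s \<in> S"
  then obtain u where u: "u \<in> subfield_GF p l - {0}" "(\<Prod>t\<in>insert 0 S - {s}. s - t) = \<beta> * u"
    using nodes by blast
  then have "\<beta> / (\<Prod>t\<in>insert 0 S - {s}. s - t) = inverse u" using assms(1) by (simp add: divide_inverse)
  then show "\<beta> / (\<Prod>t\<in>insert 0 S - {s}. s - t) \<in> subfield_GF p l - {0}"
    using u subfield_GF_inverse[of u p l] by auto
next
  show "- \<beta> / (\<Prod>t\<in>S. 0 - t) \<noteq> 0" using assms(1) S0 by (simp add: prod_zero_iff)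
next
  fix F :: "'a poly" assume "Polynomial.degree F + 1 \<le> card S"
  then have "(\<Sum>s\<in>insert 0 S. \<beta> * (poly F s / (\<Prod>t\<in>insert 0 S - {s}. s - t))) = 0"
    unfolding sum_distrib_left[symmetric] using S0 by (subst sum_poly_over_node_derivative) auto
  moreover have "insert 0 S - {0} = S" using S0 by auto
  ultimately have "(\<Sum>s\<in>S. \<beta> * (poly F s / (\<Prod>t\<in>insert 0 S - {s}. s - t))) + \<beta> * (poly F 0 / (\<Prod>t\<in>S. 0 - t)) = 0"
    using S0 by (subst (asm) sum.insert) (auto simp: add.commute)
  then show "(\<Sum>s\<in>S. \<beta> / (\<Prod>t\<in>insert 0 S - {s}. s - t) * poly F s) =
      (\<Sum>z\<in>{0}. - \<beta> / (\<Prod>t\<in>S. 0 - t) * poly F z)"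
    by (simp add: eq_neg_iff_add_eq_0)
qed

text \<open>The identity on \<open>insert 0 S\<close> is applied to \<open>x ^ m * F\<close>. This
  kills the term at \<open>0\<close> and multiplies the weights by \<open>s ^ m\<close>, which keeps
  them in the subfield; the cost is \<open>m\<close> in the degree bound.\<close>

lemma galois_weights_nodes_power:
  assumes "\<beta> \<noteq> 0" and S0: "0 \<notin> S" and m: "m > 0"
    and nodes: "\<And>s. s \<in> S \<Longrightarrow> \<exists>u\<in>subfield_GF p l - {0}. (\<Prod>t\<in>insert 0 S - {s}. s - t) = \<beta> * u"
    and pow: "\<And>s. s \<in> S \<Longrightarrow> s ^ m \<in> subfield_GF p l"
  shows "galois_weights S {} (m + 1)"
proof (rule galois_weightsI[where \<mu> = "\<lambda>s. \<beta> * s ^ m / (\<Prod>t\<in>insert 0 S - {s}. s - t)" and c = "\<lambda>_. 1"])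
  fix s assume s: "s \<in> S"
  then obtain u where u: "u \<in> subfield_GF p l - {0}" "(\<Prod>t\<in>insert 0 S - {s}. s - t) = \<beta> * u"
    using nodes by blast
  then have "\<beta> * s ^ m / (\<Prod>t\<in>insert 0 S - {s}. s - t) = s ^ m * inverse u"
    using assms(1) by (simp add: divide_inverse)
  moreover have "s ^ m * inverse u \<noteq> 0" using s S0 u by auto
  moreover have "s ^ m * inverse u \<in> subfield_GF p l"
    using pow[OF s] u by (intro subfield_GF_mult subfield_GF_inverse) auto
  ultimately show "\<beta> * s ^ m / (\<Prod>t\<in>insert 0 S - {s}. s - t) \<in> subfield_GF p l - {0}"
    by simp
next
  fix F :: "'a poly" assume F: "Polynomial.degree F + (m + 1) \<le> card S"
  have "Polynomial.degree (Polynomial.monom 1 m * F) \<le> m + Polynomial.degree F"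
    by (rule order_trans[OF degree_mult_le]) (simp add: degree_monom_le)
  then have "(\<Sum>s\<in>insert 0 S. \<beta> * (poly (Polynomial.monom 1 m * F) s / (\<Prod>t\<in>insert 0 S - {s}. s - t))) = 0"
    unfolding sum_distrib_left[symmetric] using S0 F by (subst sum_poly_over_node_derivative) auto
  then have "(\<Sum>s\<in>S. \<beta> * (poly (Polynomial.monom 1 m * F) s / (\<Prod>t\<in>insert 0 S - {s}. s - t))) = 0"
    using S0 m by (subst (asm) sum.insert) (auto simp: poly_monom zero_power)
  then show "(\<Sum>s\<in>S. \<beta> * s ^ m / (\<Prod>t\<in>insert 0 S - {s}. s - t) * poly F s) = (\<Sum>z\<in>{}. 1 * poly F z)"
    by (simp add: poly_monom mult_ac)
qed auto

section \<open>Preimages of subfield elements under power maps\<close>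

context
  fixes d :: nat and T S :: "'a set"
  assumes d: "d dvd CARD('a) - 1" and T: "T \<subseteq> subfield_GF p l - {0}" and S: "S = {x. x ^ d \<in> T}"
begin

lemma power_preimage_nonzero: "0 \<notin> S"
  using d T card_gt_1 by (cases "d = 0") (auto simp: S)

text \<open>The Frobenius power permutes the \<open>d\<close>-th roots of unity other than
  \<open>1\<close>, hence fixes this product.\<close>

lemma unity_node_in_GF: "(\<Prod>z\<in>{z :: 'a. z ^ d = 1} - {1}. 1 - z) \<in> subfield_GF p l - {0}"
proof -
  let ?Z = "{z :: 'a. z ^ d = 1} - {1}"
  have inj: "inj_on (\<lambda>z. z ^ p ^ l) ?Z" using inj_frobenius by (rule inj_on_subset) simp
  have "(\<lambda>z. z ^ p ^ l) ` ?Z \<subseteq> ?Z"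
  proof (rule image_subsetI)
    fix z :: 'a assume "z \<in> ?Z"
    then have z: "z ^ d = 1" "z \<noteq> 1" by auto
    have "(z ^ p ^ l) ^ d = (z ^ d) ^ p ^ l" by (simp flip: power_mult add: mult.commute)
    moreover have "z ^ p ^ l \<noteq> 1" using injD[OF inj_frobenius, of z 1] z by auto
    ultimately show "z ^ p ^ l \<in> ?Z" using z by simp
  qed
  then have bij: "bij_betw (\<lambda>z. z ^ p ^ l) ?Z ?Z"
    using inj by (simp add: bij_betw_def endo_inj_surj)
  have "(\<Prod>z\<in>?Z. 1 - z) ^ p ^ l = (\<Prod>z\<in>?Z. 1 - z ^ p ^ l)"
    by (simp add: frobenius_power_diff[OF prime char] prod_power_distrib)
  also have "\<dots> = (\<Prod>z\<in>?Z. 1 - z)" using bij by (rule prod.reindex_bij_betw)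
  finally show ?thesis by (auto simp: subfield_GF_def)
qed

text \<open>The fibre of \<open>s\<close> under \<open>x ^ d\<close> is \<open>s\<close> times the
  \<open>d\<close>-th roots of unity, so it contributes \<open>s ^ (d - 1)\<close> times a constant.
  The extra node \<open>0\<close> supplies the missing factor \<open>s\<close>, and
  \<open>s ^ d\<close> lies in \<open>T\<close>, hence in the subfield.\<close>

lemma power_preimage_nodes:
  shows "s \<in> S \<Longrightarrow> \<exists>u\<in>subfield_GF p l - {0}.
      (\<Prod>t\<in>insert 0 S - {s}. s - t) = (\<Prod>z\<in>{z :: 'a. z ^ d = 1} - {1}. 1 - z) * u"
    and "(\<Prod>t\<in>S. 0 - t) \<in> subfield_GF p l - {0}"
proof -
  \<comment> \<open>Values of \<open>T\<close> that are not \<open>d\<close>-th powers have empty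
    fibres. After discarding them every fibre has the full size \<open>d\<close>.\<close>
  define T' where "T' = T \<inter> range (\<lambda>x. x ^ d)"
  define P where "P = (Polynomial.monom 1 d :: 'a poly)"
  have dpos: "d > 0" using d card_gt_1 by (auto intro!: Nat.gr0I)
  have P: "poly P x = x ^ d" for x by (simp add: P_def poly_monom)
  have degP: "Polynomial.degree P = d" by (simp add: P_def degree_monom_eq)
  have monic: "lead_coeff P = 1" unfolding degP by (simp add: P_def)
  have SP: "S = {x. poly P x \<in> T'}" by (auto simp: S P T'_def)
  have fib: "card {x. poly P x = b} = Polynomial.degree P" if "b \<in> T'" for b
  proof -
    from that obtain a where a: "b = a ^ d" by (auto simp: T'_def)
    have a0: "a \<noteq> 0" using that T dpos a by (auto simp: T'_def)
    have "card {x. poly P x = b} = card ((\<lambda>z. a * z) ` {z. z ^ d = 1})"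
      using power_fibre_eq[OF a0, of d] by (simp add: P a)
    also have "\<dots> = card {z :: 'a. z ^ d = 1}"
      using a0 by (intro card_image inj_onI) simp
    also have "\<dots> = d" using prim d by (rule roots_of_unity_eq)
    finally show ?thesis by (simp add: degP)
  qed
  have dif: "b - b' \<in> subfield_GF p l" if "b \<in> T'" "b' \<in> T'" for b b'
    using that T by (intro GF_diff) (auto simp: T'_def)
  { assume s: "s \<in> S"
    have s0: "s \<noteq> 0" using s power_preimage_nonzero by auto
    have sT: "poly P s \<in> T'" using s SP by simp
    have "{x. poly P x = poly P s} - {s} = (\<lambda>z. s * z) ` ({z. z ^ d = 1} - {1})"
      using power_fibre_eq[OF s0, of d] s0 by (auto simp: P)
    then have "(\<Prod>t\<in>{x. poly P x = poly P s} - {s}. s - t) =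
        (\<Prod>t\<in>(\<lambda>z. s * z) ` ({z. z ^ d = 1} - {1}). s - t)" by simp
    also have "\<dots> = (\<Prod>z\<in>{z. z ^ d = 1} - {1}. s * (1 - z))"
      using s0 by (subst prod.reindex) (auto simp: inj_on_def algebra_simps)
    also have "\<dots> = s ^ (d - 1) * (\<Prod>z\<in>{z. z ^ d = 1} - {1}. 1 - z)"
      using roots_of_unity_eq(2)[OF prim d] by (simp add: prod.distrib card_Diff_singleton)
    finally have fibre: "(\<Prod>t\<in>{x. poly P x = poly P s} - {s}. s - t) =
      s ^ (d - 1) * (\<Prod>z\<in>{z. z ^ d = 1} - {1}. 1 - z)" .
    have sd: "s * s ^ (d - 1) = s ^ d" using dpos by (simp flip: power_Suc)
    define u where "u = s ^ d * (\<Prod>b\<in>T' - {poly P s}. poly P s - b)"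
    have "insert 0 S - {s} = insert 0 (S - {s})" using s0 by auto
    then have "(\<Prod>t\<in>insert 0 S - {s}. s - t) = s * (\<Prod>t\<in>S - {s}. s - t)"
      using power_preimage_nonzero by simp
    also have "(\<Prod>t\<in>S - {s}. s - t) = s ^ (d - 1) * (\<Prod>z\<in>{z. z ^ d = 1} - {1}. 1 - z) *
        (\<Prod>b\<in>T' - {poly P s}. poly P s - b)"
      unfolding SP using prod_diff_preimage_remove[OF monic _ fib sT] dpos degP fibre by simp
    also have "s * \<dots> = (\<Prod>z\<in>{z. z ^ d = 1} - {1}. 1 - z) * u"
      unfolding u_def sd[symmetric] by (simp only: mult_ac)
    finally have "(\<Prod>t\<in>insert 0 S - {s}. s - t) = (\<Prod>z\<in>{z :: 'a. z ^ d = 1} - {1}. 1 - z) * u" .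
    moreover have "u \<in> subfield_GF p l"
      unfolding u_def using sT T dif P by (intro subfield_GF_mult subfield_GF_prod) (auto simp: T'_def)
    moreover have "u \<noteq> 0" using s0 by (auto simp: u_def)
    ultimately show "\<exists>u\<in>subfield_GF p l - {0}.
      (\<Prod>t\<in>insert 0 S - {s}. s - t) = (\<Prod>z\<in>{z :: 'a. z ^ d = 1} - {1}. 1 - z) * u" by blast
  }
  have "(\<Prod>t\<in>S. 0 - t) = (\<Prod>b\<in>T'. 0 - b)"
    unfolding SP using prod_diff_preimage[OF monic _ fib, of T' 0] dpos degP by (simp add: P power_0_left)
  moreover have "(\<Prod>b\<in>T'. 0 - b) \<in> subfield_GF p l"
    using T GF_0 by (intro subfield_GF_prod GF_diff) (auto simp: T'_def)
  moreover have "(\<Prod>b\<in>T'. 0 - b) \<noteq> 0" using T by (auto simp: T'_def)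
  ultimately show "(\<Prod>t\<in>S. 0 - t) \<in> subfield_GF p l - {0}" by simp
qed

lemma galois_weights_power_preimage: "galois_weights S {0} 1"
  using unity_node_in_GF power_preimage_nonzero power_preimage_nodes(1)
  by (intro galois_weights_nodes_zero) auto

lemma galois_weights_power_preimage': "galois_weights S {} (d + 1)"
  using unity_node_in_GF power_preimage_nonzero power_preimage_nodes(1) T d card_gt_1
  by (intro galois_weights_nodes_power) (auto simp: S intro!: Nat.gr0I)

text \<open>With \<open>0\<close> an actual node, its node product must share the class of the
  others. It lies in the subfield, and so does the product over the roots of unity, so
  \<open>\<beta> = 1\<close> works for all nodes.\<close>

lemma galois_weights_insert_0_power_preimage: "galois_weights (insert 0 S) {} 2"
proof (rule galois_weights_nodes[of 1])
  fix s assume s: "s \<in> insert 0 S"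
  show "\<exists>u\<in>subfield_GF p l - {0}. (\<Prod>t\<in>insert 0 S - {s}. s - t) = 1 * u"
  proof (cases "s = 0")
    case True
    then show ?thesis using power_preimage_nodes(2) power_preimage_nonzero by simp
  next
    case False
    with s obtain u where "u \<in> subfield_GF p l - {0}"
      "(\<Prod>t\<in>insert 0 S - {s}. s - t) = (\<Prod>z\<in>{z :: 'a. z ^ d = 1} - {1}. 1 - z) * u"
      using power_preimage_nodes(1) by blast
    with unity_node_in_GF show ?thesis by (auto intro: subfield_GF_mult)
  qed
qed simp

end

section \<open>Fibres of additive polynomials and of the trace\<close>

lemma additive_fibre_eq:
  fixes P :: "'a poly"
  assumes "0 \<in> V" and minus: "\<And>u v. u \<in> V \<Longrightarrow> v \<in> V \<Longrightarrow> u - v \<in> V"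
    and deg: "Polynomial.degree P = card V"
    and inv: "\<And>x v. v \<in> V \<Longrightarrow> poly P (x + v) = poly P x"
  shows "{x. poly P x = poly P a} = (\<lambda>v. a + v) ` V"
proof -
  \<comment> \<open>Translation invariance puts the coset \<open>a + V\<close> into the fibre, and
    the degree bounds the fibre by \<open>card V\<close>; equality then follows by counting.\<close>
  have "card V > 0" using assms(1) by (auto simp: card_gt_0_iff)
  then have "P \<noteq> [:poly P a:]" using deg by (metis degree_pCons_0 less_irrefl)
  then have "P - [:poly P a:] \<noteq> 0" by simp
  then have "card {x. poly (P - [:poly P a:]) x = 0} \<le> Polynomial.degree (P - [:poly P a:])"
    by (rule card_poly_roots_bound)
  also have "\<dots> \<le> card V" by (intro degree_diff_le) (simp_all add: deg)
  finally have "card {x. poly P x = poly P a} \<le> card V" by simp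
  then show ?thesis
    using inv by (intro card_seteq[symmetric]) (auto simp: card_image)
qed

text \<open>Fibres are cosets \<open>s + V\<close>, so the differences inside a fibre are the
  elements \<open>- v\<close>, and their product is the same for all \<open>s\<close>. It serves as
  \<open>\<beta>\<close> without an extra node.\<close>

lemma galois_weights_additive:
  fixes P :: "'a poly"
  assumes V: "0 \<in> V" "\<And>u v. u \<in> V \<Longrightarrow> v \<in> V \<Longrightarrow> u - v \<in> V"
    and deg: "Polynomial.degree P = card V" and monic: "lead_coeff P = 1"
    and inv: "\<And>x v. v \<in> V \<Longrightarrow> poly P (x + v) = poly P x"
    and T: "T \<subseteq> subfield_GF p l"
  shows "galois_weights {x. poly P x \<in> T} {} 2"
proof (rule galois_weights_nodes)
  have fib: "{x. poly P x = poly P a} = (\<lambda>v. a + v) ` V" for a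
    using V deg inv by (rule additive_fibre_eq)
  define T' where "T' = T \<inter> range (poly P)"
  have SP: "{x. poly P x \<in> T} = {x. poly P x \<in> T'}" by (auto simp: T'_def)
  have fibc: "card {x. poly P x = b} = Polynomial.degree P" if "b \<in> T'" for b
    using that deg fib by (auto simp: T'_def card_image)
  have degpos: "Polynomial.degree P > 0" using V(1) deg by (auto simp: card_gt_0_iff)
  show "(\<Prod>v\<in>V - {0}. - v) \<noteq> 0" by auto
  fix s assume "s \<in> {x. poly P x \<in> T}"
  then have sT: "poly P s \<in> T'" by (simp add: T'_def)
  have "{x. poly P x = poly P s} - {s} = (\<lambda>v. s + v) ` (V - {0})" using fib[of s] by auto
  then have "(\<Prod>t\<in>{x. poly P x = poly P s} - {s}. s - t) = (\<Prod>t\<in>(\<lambda>v. s + v) ` (V - {0}). s - t)"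
    by simp
  also have "\<dots> = (\<Prod>v\<in>V - {0}. - v)" by (subst prod.reindex) auto
  finally have "(\<Prod>t\<in>{x. poly P x \<in> T} - {s}. s - t) =
      (\<Prod>v\<in>V - {0}. - v) * (\<Prod>b\<in>T' - {poly P s}. poly P s - b)"
    unfolding SP using prod_diff_preimage_remove[OF monic degpos fibc sT] by simp
  moreover have "(\<Prod>b\<in>T' - {poly P s}. poly P s - b) \<in> subfield_GF p l"
    using T sT by (intro subfield_GF_prod GF_diff) (auto simp: T'_def)
  moreover have "(\<Prod>b\<in>T' - {poly P s}. poly P s - b) \<noteq> 0" by auto
  ultimately show "\<exists>u\<in>subfield_GF p l - {0}.
      (\<Prod>t\<in>{x. poly P x \<in> T} - {s}. s - t) = (\<Prod>v\<in>V - {0}. - v) * u" by blast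
qed

lemma L_fun_poly: "L_fun V x = poly (\<Prod>v\<in>V. [:- v, 1:]) x"
  by (simp add: L_fun_def poly_prod)

lemma L_fun_translate:
  fixes V :: "'a set"
  assumes V: "\<And>u v. u \<in> V \<Longrightarrow> v \<in> V \<Longrightarrow> u - v \<in> V" and v: "v \<in> V"
  shows "L_fun V (x + v) = L_fun V x"
  unfolding L_fun_def
proof (rule prod.reindex_bij_witness[of _ "\<lambda>u. u + v" "\<lambda>u. u - v"])
  fix u assume "u \<in> V"
  moreover have "0 - v \<in> V" using V v by (metis diff_self)
  ultimately show "u + v \<in> V" using V[of u "0 - v"] by simp
qed (use assms in auto)

text \<open>\<open>ring.dimension\<close> is inductive: a subspace arises from the zero space by
  successive line extensions. Closure under differences is carried through that induction.\<close>

lemma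
  assumes "Fp_subspace p r (V :: 'a set)"
  shows Fp_subspace_zero: "0 \<in> V" and Fp_subspace_diff: "\<And>u v. u \<in> V \<Longrightarrow> v \<in> V \<Longrightarrow> u - v \<in> V"
proof -
  have R: "ring (class_ring :: 'a ring)" by (rule class_ring.ring_axioms)
  have "ring.dimension class_ring r (subfield_GF p 1) V"
    using assms by (simp add: Fp_subspace_def)
  then have "0 \<in> V \<and> (\<forall>u\<in>V. \<forall>v\<in>V. u - v \<in> V)"
  proof (induction r "subfield_GF p 1 :: 'a set" V rule: ring.dimension.induct[OF R, consumes 1])
    case (2 x E n)
    have mem: "u \<in> ring.line_extension class_ring (subfield_GF p 1) x E \<longleftrightarrow>
        (\<exists>k\<in>subfield_GF p 1. \<exists>v\<in>E. u = k * x + v)" for u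
      using ring.line_extension_mem_iff[OF R] by simp
    have "0 \<in> ring.line_extension class_ring (subfield_GF p 1) x E"
      unfolding mem using 2 prime by (intro bexI[of _ 0]) (auto simp: prime_gt_0_nat)
    moreover have "u - v \<in> ring.line_extension class_ring (subfield_GF p 1) x E"
      if uv: "u \<in> ring.line_extension class_ring (subfield_GF p 1) x E"
        "v \<in> ring.line_extension class_ring (subfield_GF p 1) x E" for u v
    proof -
      obtain k u' k' v' where "k \<in> subfield_GF p 1" "u' \<in> E" "u = k * x + u'"
        "k' \<in> subfield_GF p 1" "v' \<in> E" "v = k' * x + v'"
        using uv unfolding mem by auto
      moreover from this have "k - k' \<in> subfield_GF p 1" using subfield_GF_diff[OF prime char] by blast
      ultimately show ?thesis
        unfolding mem using 2 by (intro bexI[of _ "k - k'"] bexI[of _ "u' - v'"]) (auto simp: algebra_simps)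
    qed
    ultimately show ?case by (intro conjI ballI)
  qed simp
  then show "0 \<in> V" "\<And>u v. u \<in> V \<Longrightarrow> v \<in> V \<Longrightarrow> u - v \<in> V" by auto
qed

lemma L_fun_fibre:
  assumes V: "Fp_subspace p r (V :: 'a set)"
  shows "{x. L_fun V x = L_fun V a} = (\<lambda>v. a + v) ` V"
  unfolding L_fun_poly
  by (rule additive_fibre_eq)
    (use Fp_subspace_zero[OF V] Fp_subspace_diff[OF V] L_fun_translate[of V] in
      \<open>auto simp: degree_prod_linear simp flip: L_fun_poly\<close>)

lemma galois_weights_R8:
  assumes "evset_R8 p l S"
  shows "galois_weights S {} 2"
proof -
  obtain V r T where V: "Fp_subspace p r V" and T: "T \<subseteq> range (L_fun V) \<inter> subfield_GF p l"
    and S: "S = {x. L_fun V x \<in> T}" using assms by (auto simp: evset_R8_def)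
  note V' = Fp_subspace_zero[OF V] Fp_subspace_diff[OF V]
  have "galois_weights {x. poly (\<Prod>v\<in>V. [:- v, 1:]) x \<in> T} {} 2"
  proof (rule galois_weights_additive[of V])
    show "lead_coeff (\<Prod>v\<in>V. [:- v, 1:]) = 1" by (simp add: lead_coeff_prod)
  qed (use V' T L_fun_translate[of V] in \<open>auto simp: degree_prod_linear simp flip: L_fun_poly\<close>)
  then show ?thesis by (simp add: S L_fun_poly)
qed

text \<open>The trace is additive and maps into the subfield. Its degree \<open>p ^ (e - l)\<close>
  must equal the size of its kernel for the fibres to be full; this follows by counting, since at
  most \<open>p ^ l\<close> fibres of equal size cover the field.\<close>

lemma galois_weights_R7:
  assumes "evset_R7 p e l S"
  shows "galois_weights S {} 2"
proof -
  obtain T where T: "T \<subseteq> subfield_GF p l" and S: "S = {x. rel_trace p e l x \<in> T}"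
    using assms by (auto simp: evset_R7_def)
  define N where "N = e div l"
  define P :: "'a poly" where "P = (\<Sum>i<N. Polynomial.monom 1 (p ^ (i * l)))"
  have e: "e = N * l" using dvd by (auto simp: N_def elim!: dvdE)
  have "e > 0" using card_gt_1 card by (auto intro!: Nat.gr0I)
  then obtain M where M: "N = Suc M" using e by (cases N) auto
  have P: "poly P x = rel_trace p e l x" for x
    by (simp add: P_def rel_trace_def N_def poly_sum poly_monom)
  have less: "p ^ (i * l) < p ^ (M * l)" if "i < M" for i
    using that prime l by (intro power_strict_increasing) (auto simp: prime_gt_Suc_0_nat)
  have P': "P = (\<Sum>i<M. Polynomial.monom 1 (p ^ (i * l))) + Polynomial.monom 1 (p ^ (M * l))"
    by (simp add: P_def M)
  have ppos: "p ^ (M * l) > 0" using prime by (simp add: prime_gt_0_nat)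
  have "Polynomial.degree (\<Sum>i<M. Polynomial.monom 1 (p ^ (i * l)) :: 'a poly) < p ^ (M * l)"
    using less ppos by (intro degree_lessI disjI2 allI impI) (force simp: coeff_sum intro!: sum.neutral)+
  then have degP: "Polynomial.degree P = p ^ (M * l)"
    unfolding P' by (subst degree_add_eq_right) (simp_all add: degree_monom_eq)
  have monic: "lead_coeff P = 1"
    unfolding degP unfolding P' using less by (force simp: coeff_sum intro!: sum.neutral)
  have add: "poly P (x - y) = poly P x - poly P y" for x y
    unfolding P rel_trace_def by (simp add: frobenius_power_diff[OF prime char] sum_subtractf)
  have range: "poly P x \<in> subfield_GF p l" for x
  proof -
    have "poly P x ^ p ^ l = (\<Sum>i<N. (x ^ p ^ (i * l)) ^ p ^ l)"
      unfolding P rel_trace_def N_def[symmetric]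
      using prime char by (intro freshmans_dream_sum'[of _ l]) auto
    also have "\<dots> = (\<Sum>i<N. x ^ p ^ (Suc i * l))"
      by (simp add: power_add mult.commute flip: power_mult)
    \<comment> \<open>The Frobenius power shifts the summation index by one; the new top term is
      \<open>x ^ q = x\<close> and replaces the term lost at the bottom.\<close>
    also have "\<dots> = (\<Sum>i<Suc M. x ^ p ^ (i * l)) - x + x ^ p ^ (N * l)"
      using sum.lessThan_Suc_shift[of "\<lambda>i. x ^ p ^ (i * l)" M] unfolding M by simp
    also have "x ^ p ^ (N * l) = x"
    proof (cases "x = 0")
      case False
      have "x ^ CARD('a) = x ^ (CARD('a) - 1) * x" using card_gt_1 by (simp flip: power_Suc2)
      then show ?thesis using finite_field_power_card_minus_1[OF False] card e by simp
    qed (use prime in \<open>simp add: power_0_left prime_gt_0_nat\<close>)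
    finally show ?thesis unfolding P rel_trace_def N_def[symmetric] by (simp add: subfield_GF_def M)
  qed
  define V where "V = {x. poly P x = 0}"
  have P0: "poly P 0 = 0" using add[of 0 0] by simp
  have fibre: "card {x. poly P x = poly P a} = card V" for a
  proof -
    have "{x. poly P x = poly P a} = (\<lambda>v. a + v) ` V"
    proof (intro equalityI subsetI)
      fix x assume "x \<in> {x. poly P x = poly P a}"
      then have "x - a \<in> V" by (simp add: V_def add)
      then show "x \<in> (\<lambda>v. a + v) ` V" by (intro image_eqI[of _ _ "x - a"]) auto
    next
      fix x assume "x \<in> (\<lambda>v. a + v) ` V"
      then obtain v where "x = a + v" "poly P v = 0" by (auto simp: V_def)
      then have "poly P (x - a) = 0" by simp
      then show "x \<in> {x. poly P x = poly P a}" by (simp add: add)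
    qed
    then show ?thesis by (simp add: card_image)
  qed
  have "CARD('a) = card (\<Union>b\<in>range (poly P). {x. poly P x = b})"
    by (rule arg_cong[of _ _ card]) blast
  also have "\<dots> = (\<Sum>b\<in>range (poly P). card {x. poly P x = b})"
    by (rule card_UN_disjoint) auto
  also have "\<dots> = (\<Sum>b\<in>range (poly P). card V)"
    using fibre by (intro sum.cong) auto
  also have "\<dots> = card (range (poly P)) * card V" by simp
  also have "\<dots> \<le> p ^ l * card V"
  proof (rule mult_right_mono)
    have "card (range (poly P)) \<le> card (subfield_GF p l :: 'a set)"
      using range by (intro card_mono) auto
    also have "\<dots> \<le> p ^ l" using Q_gt_1 by (rule card_subfield_GF_le)
    finally show "card (range (poly P)) \<le> p ^ l" .
  qed simp
  finally have "p ^ l * p ^ (M * l) \<le> p ^ l * card V" by (simp add: card e M power_add)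
  then have "p ^ (M * l) \<le> card V" using Q_gt_1 l prime by (simp add: prime_gt_0_nat)
  moreover have "P \<noteq> 0" using degP ppos by auto
  then have "card V \<le> p ^ (M * l)"
    using card_poly_roots_bound[of P] degP by (simp add: V_def)
  ultimately have "Polynomial.degree P = card V" using degP by simp
  then have "galois_weights {x. poly P x \<in> T} {} 2"
    using T monic
  proof (intro galois_weights_additive[of V])
    show "poly P (x + v) = poly P x" if "v \<in> V" for x v
      using add[of "x + v" v] that by (simp add: V_def)
  qed (auto simp: V_def add P0)
  then show ?thesis by (simp add: S P)
qed

section \<open>Reduction of the remaining evaluation sets to power preimages\<close>

lemma GF_order_dvd: "p ^ l - 1 dvd CARD('a) - 1"
proof -
  have "CARD('a) = (p ^ l) ^ (e div l)"
    using dvd card by (simp add: dvd_mult_div_cancel dvd_mult_right flip: power_mult)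
  then show ?thesis using power_minus_one_dvd[of "p ^ l" "e div l"] by simp
qed

lemma index_dvd: "(CARD('a) - 1) div (p ^ l - 1) dvd CARD('a) - 1"
  using GF_order_dvd by (metis dvd_div_mult_self dvd_triv_left)

lemma w_power_mem_GF:
  assumes "CARD('a) - 1 dvd i * (p ^ l - 1)"
  shows "w ^ i \<in> subfield_GF p l - {0}"
proof -
  have "w ^ i \<noteq> 0" using prim by (simp add: primitive_element_def)
  moreover have "(w ^ i) ^ (p ^ l - 1) = 1"
    using assms primitive_element_power_eq_1_iff[OF prim] by (simp flip: power_mult)
  ultimately show ?thesis using mem_subfield_GF_iff[of "w ^ i" p l] prime by (simp add: prime_gt_0_nat)
qed

text \<open>The common shape of \<open>evset_R1\<close>, \<open>evset_R3\<close>,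
  \<open>evset_R5\<close>, \<open>evset_R9\<close> and, once \<open>0\<close> is removed, of
  \<open>evset_R2\<close>, \<open>evset_R4\<close>, \<open>evset_R6\<close>,
  \<open>evset_R10\<close>. Values in \<open>T\<close> may fail to be attained.\<close>

definition power_preimage :: "nat \<Rightarrow> 'a set \<Rightarrow> bool" where
  "power_preimage d S \<longleftrightarrow> d dvd CARD('a) - 1 \<and> (\<exists>T \<subseteq> subfield_GF p l - {0}. S = {x. x ^ d \<in> T})"

lemma power_preimageI:
  "d dvd CARD('a) - 1 \<Longrightarrow> T \<subseteq> subfield_GF p l - {0} \<Longrightarrow> S = {x. x ^ d \<in> T} \<Longrightarrow> power_preimage d S"
  by (auto simp: power_preimage_def)

lemma
  assumes "power_preimage d S"
  shows power_preimage_weights: "galois_weights S {0} 1"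
    and power_preimage_weights': "galois_weights S {} (d + 1)"
    and power_preimage_weights_insert: "galois_weights (insert 0 S) {} 2"
    and power_preimage_not_zero: "0 \<notin> S"
  using assms galois_weights_power_preimage[of d _ S] galois_weights_power_preimage'[of d _ S]
    galois_weights_insert_0_power_preimage[of d _ S] power_preimage_nonzero[of d _ S]
  by (auto simp: power_preimage_def)

lemma power_preimage_R1:
  assumes "evset_R1 p l S"
  shows "\<exists>d. power_preimage d S"
proof -
  obtain T where T: "T \<subseteq> subfield_GF p l - {0}"
    and S: "S = {x. x \<noteq> 0 \<and> x ^ ((CARD('a) - 1) div (p ^ l - 1)) \<in> T}"
    using assms by (auto simp: evset_R1_def)
  have "(CARD('a) - 1) div (p ^ l - 1) > 0"
    using index_dvd card_gt_1 by (auto intro!: Nat.gr0I)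
  then have "S = {x. x ^ ((CARD('a) - 1) div (p ^ l - 1)) \<in> T}"
    using T S by (auto simp: zero_power)
  with T index_dvd show ?thesis by (blast intro: power_preimageI)
qed

text \<open>The exponent is \<open>d = r2\<close>. The powers of \<open>w ^ x2\<close> are all the
  \<open>r2\<close>-th roots of unity, so \<open>S\<close> consists of full fibres of
  \<open>x ^ r2\<close> through the points \<open>w ^ (x1 * j)\<close>. Those points lie in the
  subfield because \<open>x1\<close> is a multiple of the index of its unit group.\<close>

lemma power_preimage_R3:
  assumes "evset_R3 p l w S"
  shows "\<exists>d. power_preimage d S"
proof -
  obtain x1 x2 r1 r2 where x: "0 < x1" "0 < x2"
    and dv: "(CARD('a) - 1) div (p ^ l - 1) dvd x1"
    and r2: "r2 = (CARD('a) - 1) div gcd x2 (CARD('a) - 1)"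
    and S: "S = {(w ^ x1) ^ j * (w ^ x2) ^ v | j v. j \<in> {1..r1} \<and> v \<in> {1..r2}}"
    using assms unfolding evset_R3_def by auto
  define g where "g = gcd x2 (CARD('a) - 1)"
  have g: "g > 0" using x by (simp add: g_def)
  \<comment> \<open>Coprimality of the reduced numbers \<open>c\<close> and \<open>r\<close> makes
    \<open>r = r2\<close> the exact order of \<open>w ^ x2\<close>.\<close>
  obtain c r where cr: "x2 = c * g" "CARD('a) - 1 = r * g" "coprime c r"
    using gcd_coprime_exists[of x2 "CARD('a) - 1"] g unfolding g_def by auto
  have "r2 = r * g div g" unfolding cr(2)[symmetric] by (simp add: r2 g_def)
  then have r: "r = r2" using g by simp
  have r2dvd: "r2 dvd CARD('a) - 1" using cr r by simp
  have pow1: "((w ^ x2) ^ v) ^ r2 = 1" for v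
  proof -
    have "((w ^ x2) ^ v) ^ r2 = w ^ ((CARD('a) - 1) * (c * v))"
      unfolding cr(1,2) r by (simp flip: power_mult add: mult_ac)
    then show ?thesis using primitive_element_power_eq_1_iff[OF prim] by simp
  qed
  have "inj_on (\<lambda>v. (w ^ x2) ^ v) {1..r2}"
  proof (intro linorder_inj_onI' notI)
    fix i j assume ij: "i \<in> {1..r2}" "j \<in> {1..r2}" "i < j" "(w ^ x2) ^ i = (w ^ x2) ^ j"
    then have "CARD('a) - 1 dvd x2 * (j - i)"
      using primitive_element_power_eq_iff[OF prim, of "x2 * i" "x2 * j"]
      by (simp add: power_mult right_diff_distrib')
    then have "g * r2 dvd g * (c * (j - i))" unfolding cr(1,2) r by (simp only: mult_ac)
    then have "r2 dvd c * (j - i)" using g by simp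
    then have "r2 dvd j - i" using cr(3) r by (simp add: coprime_commute coprime_dvd_mult_right_iff)
    with ij show False by (auto dest: dvd_imp_le)
  qed
  then have unity: "(\<lambda>v. (w ^ x2) ^ v) ` {1..r2} = {z. z ^ r2 = 1}"
    using pow1 roots_of_unity_eq(2)[OF prim r2dvd] by (intro card_seteq) (auto simp: card_image)
  define T where "T = (\<lambda>j. ((w ^ x1) ^ j) ^ r2) ` {1..r1}"
  have "CARD('a) - 1 dvd x1 * (p ^ l - 1)"
    using mult_dvd_mono[OF dv dvd_refl, of "p ^ l - 1"] unfolding dvd_div_mult_self[OF GF_order_dvd] .
  then have T: "T \<subseteq> subfield_GF p l - {0}"
    using w_power_mem_GF[of x1] by (auto simp: T_def intro!: subfield_GF_power)
  have "S = {x. x ^ r2 \<in> T}"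
  proof (intro equalityI subsetI)
    fix x assume "x \<in> S"
    then show "x \<in> {x. x ^ r2 \<in> T}" using pow1 by (auto simp: S T_def power_mult_distrib)
  next
    fix x assume "x \<in> {x. x ^ r2 \<in> T}"
    then obtain j where j: "j \<in> {1..r1}" "x ^ r2 = ((w ^ x1) ^ j) ^ r2" by (auto simp: T_def)
    have "(w ^ x1) ^ j \<noteq> 0" using prim by (simp add: primitive_element_def)
    from power_fibre_eq[OF this, of r2] j(2) have "x \<in> (\<lambda>z. (w ^ x1) ^ j * z) ` {z. z ^ r2 = 1}" by auto
    then obtain v where "v \<in> {1..r2}" "x = (w ^ x1) ^ j * (w ^ x2) ^ v" unfolding unity[symmetric] by blast
    then show "x \<in> S" unfolding S using j(1) by blast
  qed
  with T r2dvd show ?thesis by (blast intro: power_preimageI)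
qed

text \<open>The exponent is \<open>d = m\<close>. \<open>H\<close> is the group of
  \<open>m\<close>-th roots of unity, so its cosets are fibres of \<open>x ^ m\<close>, and the
  \<open>m\<close>-th powers of elements of \<open>G\<close> fall into the subfield.\<close>

lemma power_preimage_R5:
  assumes "evset_R5 p l w S"
  shows "\<exists>d. power_preimage d S"
proof -
  obtain m y m1 m2 r H G K where y: "y = (CARD('a) - 1) div (p ^ l - 1)" and m: "m dvd CARD('a) - 1"
    and m2: "m2 = gcd m y" and H: "H = powers (w ^ ((CARD('a) - 1) div m))"
    and G: "G = powers (w ^ (y div m2))"
    and K: "K \<subseteq> {(\<lambda>h. g * h) ` H | g. g \<in> G}" and S: "S = \<Union>K"
    using assms unfolding evset_R5_def by blast
  have unity: "{z. z ^ m = 1} \<subseteq> H"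
    unfolding H powers_def using roots_of_unity_eq(1)[OF prim m] by (auto simp: power_mult)
  have Hm: "h ^ m = 1" if h: "h \<in> H" for h
  proof -
    obtain i where "h = (w ^ ((CARD('a) - 1) div m)) ^ i" using h by (auto simp: H powers_def)
    then have "h ^ m = w ^ ((CARD('a) - 1) div m * m * i)" by (simp add: mult_ac flip: power_mult)
    then show ?thesis using m primitive_element_power_eq_1_iff[OF prim] by simp
  qed
  have H_mult: "h * h' \<in> H" if "h \<in> H" "h' \<in> H" for h h'
    using that by (auto simp: H powers_def simp flip: power_add)
  have Gm: "g ^ m \<in> subfield_GF p l - {0}" if g: "g \<in> G" for g
  proof -
    obtain i where i: "g = (w ^ (y div m2)) ^ i" using g by (auto simp: G powers_def)
    have "m = m2 * (m div m2)" "y = y div m2 * m2" using m2 by auto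
    \<comment> \<open>Regrouping as \<open>(y / m2) * m = y * (m / m2)\<close> exhibits the exponent
      as a multiple of \<open>y\<close>, the index of the unit group of the subfield.\<close>
    then have "y div m2 * i * m * (p ^ l - 1) = y * (p ^ l - 1) * (i * (m div m2))"
      by (metis mult.assoc mult.commute)
    also have "y * (p ^ l - 1) = CARD('a) - 1" using GF_order_dvd y by simp
    finally have "CARD('a) - 1 dvd y div m2 * i * m * (p ^ l - 1)" by (metis dvd_triv_left)
    then have "w ^ (y div m2 * i * m) \<in> subfield_GF p l - {0}" by (rule w_power_mem_GF)
    then show ?thesis by (simp add: i power_mult)
  qed
  define T where "T = (\<lambda>s. s ^ m) ` S"
  have coset: "\<exists>g\<in>G. \<exists>h\<in>H. s = g * h \<and> (\<lambda>h. g * h) ` H \<in> K" if "s \<in> S" for s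
    using that K unfolding S by blast
  have T: "T \<subseteq> subfield_GF p l - {0}"
    using coset Gm Hm by (fastforce simp: T_def power_mult_distrib)
  have "S = {x. x ^ m \<in> T}"
  proof (intro equalityI subsetI)
    fix x assume "x \<in> {x. x ^ m \<in> T}"
    then obtain s where s: "s \<in> S" "x ^ m = s ^ m" by (auto simp: T_def)
    obtain g h where gh: "g \<in> G" "h \<in> H" "s = g * h" "(\<lambda>h. g * h) ` H \<in> K" using coset[OF s(1)] by blast
    have "s \<noteq> 0" using prim gh by (auto simp: G H powers_def primitive_element_def)
    from power_fibre_eq[OF this, of m] s(2) obtain z where "x = s * z" "z ^ m = 1" by auto
    then have "x = g * (h * z)" "h * z \<in> H" using gh unity H_mult by auto
    then show "x \<in> S" using gh(4) unfolding S by blast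
  qed (auto simp: T_def)
  with T m show ?thesis by (blast intro: power_preimageI)
qed

text \<open>If \<open>L_fun V y = L_fun V z\<close> with \<open>z\<close> in the subfield, then
  \<open>y - z\<close> lies in \<open>V\<close>, which is inside the subfield. So the condition on
  \<open>L_fun V (x ^ m)\<close> becomes membership of \<open>x ^ m\<close> in a set of subfield
  elements.\<close>

lemma L_fun_preimage_subset:
  assumes V: "V \<subseteq> (subfield_GF p l :: 'a set)" "Fp_subspace p r V" and T: "T \<subseteq> L_fun V ` subfield_GF p l"
  shows "{y. L_fun V y \<in> T} \<subseteq> subfield_GF p l"
proof
  fix y assume "y \<in> {y. L_fun V y \<in> T}"
  then obtain z where z: "z \<in> subfield_GF p l" "L_fun V y = L_fun V z" using T by auto
  then obtain v where v: "v \<in> V" "y = z + v" using L_fun_fibre[OF V(2), of z] by auto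
  have "z - (0 - v) \<in> subfield_GF p l" using z v V(1) GF_0 by (intro GF_diff) auto
  then show "y \<in> subfield_GF p l" using v by simp
qed

lemma L_fun_zero: "Fp_subspace p r V \<Longrightarrow> L_fun V (0 :: 'a) = 0"
  using Fp_subspace_zero unfolding L_fun_def by (auto intro!: prod_zero)

lemma power_preimage_R9:
  assumes "evset_R9 p l m S"
  shows "power_preimage m S"
proof -
  obtain V r T where V: "V \<subseteq> subfield_GF p l" "Fp_subspace p r V"
    and m: "m dvd (CARD('a) - 1) div (p ^ l - 1)"
    and T: "T \<subseteq> L_fun V ` subfield_GF p l - {0}" and S: "S = {x. L_fun V (x ^ m) \<in> T}"
    using assms unfolding evset_R9_def by blast
  \<comment> \<open>As \<open>L_fun V 0 = 0\<close> and \<open>0\<close> is not in \<open>T\<close>,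
    the preimage avoids \<open>0\<close>.\<close>
  have "{y. L_fun V y \<in> T} \<subseteq> subfield_GF p l - {0}"
    using L_fun_preimage_subset[OF V, of T] T L_fun_zero[OF V(2)] by auto
  then show ?thesis
    using dvd_trans[OF m index_dvd]
    by (intro power_preimageI[where T = "{y. L_fun V y \<in> T}"]) (auto simp: S)
qed

lemma power_preimage_R10:
  assumes "evset_R10 p l S"
  shows "\<exists>d S'. power_preimage d S' \<and> S = insert 0 S'"
proof -
  obtain V r m T where V: "V \<subseteq> subfield_GF p l" "Fp_subspace p r V"
    and m: "m dvd (CARD('a) - 1) div (p ^ l - 1)"
    and T: "T \<subseteq> L_fun V ` subfield_GF p l" "0 \<in> T" and S: "S = {x. L_fun V (x ^ m) \<in> T}"
    using assms unfolding evset_R10_def by blast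
  have md: "m dvd CARD('a) - 1" using dvd_trans[OF m index_dvd] .
  then have "m > 0" using card_gt_1 by (auto intro!: Nat.gr0I)
  then have "S = insert 0 {x. x ^ m \<in> {y. L_fun V y \<in> T} - {0}}"
    using L_fun_zero[OF V(2)] T(2) by (auto simp: S zero_power)
  moreover have "power_preimage m {x. x ^ m \<in> {y. L_fun V y \<in> T} - {0}}"
    using md L_fun_preimage_subset[OF V T(1)] by (intro power_preimageI[where T = "{y. L_fun V y \<in> T} - {0}"]) auto
  ultimately show ?thesis by blast
qed

text \<open>Here \<open>m\<close> will be \<open>0\<close>, \<open>1\<close> or the parameter of
  \<open>evset_R9\<close>, matching \<open>j = m + 1\<close> in the weights. One copy of
  \<open>p ^ l + 1\<close> is removed from both sides of
  \<open>k * (p ^ l + 1) \<le> n + p ^ l - m\<close>; since \<open>k\<close> is positive, the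
  difference on the right is not cut off at \<open>0\<close>.\<close>

lemma degree_bound:
  assumes "4 \<le> k" "k \<le> (n + p ^ l - m) div (p ^ l + 1)"
  shows "(k - 1) * (p ^ l + 1) + (m + 1) \<le> n"
proof -
  have "k * (p ^ l + 1) \<le> (n + p ^ l - m) div (p ^ l + 1) * (p ^ l + 1)"
    using assms(2) by (rule mult_right_mono) simp
  also have "\<dots> \<le> n + p ^ l - m" by (rule div_times_less_eq_dividend)
  finally have le: "k * (p ^ l + 1) \<le> n + p ^ l - m" .
  have "k * (p ^ l + 1) = (k - 1) * (p ^ l + 1) + (p ^ l + 1)"
    using assms(1) by (cases k) auto
  with le show ?thesis by linarith
qed

text \<open>Three kinds of weights match the ranges: a surviving term at \<open>0\<close> with
  \<open>j = 1\<close>, no surviving term with \<open>j = 2\<close>, and none with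
  \<open>j = m + 1\<close> for the second alternative of \<open>evset_R9\<close>. The last
  inequality reserves three dimensions for the tail and one for each element of
  \<open>E\<close>.\<close>

lemma evset_galois_weights:
  assumes n: "n = card S"
    and ev: "(evset_R1 p l S \<or> evset_R3 p l w S \<or> evset_R5 p l w S) \<and>
           4 \<le> k \<and> k \<le> (n + p ^ l) div (p ^ l + 1) \<and> h \<le> k - 4
       \<or> (evset_R2 p l S \<or> evset_R4 p l w S \<or> evset_R6 p l w S \<or>
          evset_R7 p e l S \<or> evset_R8 p l S \<or> evset_R10 p l S) \<and>
           4 \<le> k \<and> k \<le> (n + p ^ l - 1) div (p ^ l + 1) \<and> h \<le> k - 3
       \<or> (\<exists>m. evset_R9 p l m S \<and>
           (4 \<le> k \<and> k \<le> (n + p ^ l) div (p ^ l + 1) \<and> h \<le> k - 4 \<or>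
            4 \<le> k \<and> k \<le> (n + p ^ l - m) div (p ^ l + 1) \<and> h \<le> k - 3))"
  shows "4 \<le> k \<and> (\<exists>E j. galois_weights S E j \<and> 0 < j \<and> finite E \<and> E \<inter> S = {} \<and>
    (k - 1) * (p ^ l + 1) + j \<le> n \<and> h + 3 + card E \<le> k)"
  using ev
proof (elim disjE conjE exE)
  assume *: "4 \<le> k" "k \<le> (n + p ^ l) div (p ^ l + 1)" "h \<le> k - 4"
  have **: ?thesis if "power_preimage d S" for d
    using power_preimage_weights[OF that] power_preimage_not_zero[OF that] * degree_bound[of k n 0]
    by (intro conjI exI[of _ "{0}"] exI[of _ 1]) auto
  show "evset_R1 p l S \<Longrightarrow> ?thesis" using power_preimage_R1 ** by blast
  show "evset_R3 p l w S \<Longrightarrow> ?thesis" using power_preimage_R3 ** by blast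
  show "evset_R5 p l w S \<Longrightarrow> ?thesis" using power_preimage_R5 ** by blast
  show "evset_R9 p l m S \<Longrightarrow> ?thesis" for m using power_preimage_R9 ** by blast
next
  assume *: "4 \<le> k" "k \<le> (n + p ^ l - 1) div (p ^ l + 1)" "h \<le> k - 3"
  have **: ?thesis if "galois_weights S {} 2"
    using that * degree_bound[of k n 1] by (intro conjI exI[of _ "{}"] exI[of _ 2]) auto
  have ins: ?thesis if "power_preimage d S'" "S = insert 0 S'" for d S'
    using power_preimage_weights_insert[OF that(1)] that(2) ** by blast
  show "evset_R2 p l S \<Longrightarrow> ?thesis" using power_preimage_R1 ins unfolding evset_R2_def by blast
  show "evset_R4 p l w S \<Longrightarrow> ?thesis" using power_preimage_R3 ins unfolding evset_R4_def by blast
  show "evset_R6 p l w S \<Longrightarrow> ?thesis" using power_preimage_R5 ins unfolding evset_R6_def by blast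
  show "evset_R7 p e l S \<Longrightarrow> ?thesis" using galois_weights_R7 ** by blast
  show "evset_R8 p l S \<Longrightarrow> ?thesis" using galois_weights_R8 ** by blast
  show "evset_R10 p l S \<Longrightarrow> ?thesis" using power_preimage_R10 ins by blast
next
  fix m assume *: "4 \<le> k" "k \<le> (n + p ^ l - m) div (p ^ l + 1)" "h \<le> k - 3" and "evset_R9 p l m S"
  then show ?thesis
    using power_preimage_weights'[OF power_preimage_R9] degree_bound[of k n m]
    by (intro conjI exI[of _ "{}"] exI[of _ "m + 1"]) auto
qed

end

section \<open>The hull\<close>

definition GRL_tail :: "nat \<Rightarrow> 'a::field mat \<Rightarrow> 'a poly \<Rightarrow> nat \<Rightarrow> 'a" where
  "GRL_tail k A f j = vec 3 (\<lambda>i. Polynomial.coeff f (k - 3 + i)) \<bullet> col A j"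

lemma GRL_word_carrier: "GRL_word k s a v A f \<in> carrier_vec (dim_vec a + s)"
  by (rule carrier_vecI) (simp add: GRL_word_def)

lemma GRL_word_index:
  "i < dim_vec a \<Longrightarrow> GRL_word k s a v A f $ i = v $ i * poly f (a $ i)"
  "j < 3 \<Longrightarrow> GRL_word k 3 a v A f $ (dim_vec a + j) = GRL_tail k A f j"
  by (simp_all add: GRL_word_def GRL_tail_def)

lemma GRL_tail_sum:
  "A \<in> carrier_mat 3 3 \<Longrightarrow> j < 3 \<Longrightarrow> GRL_tail k A f j = (\<Sum>i<3. Polynomial.coeff f (k - 3 + i) * A $$ (i, j))"
  by (simp add: GRL_tail_def scalar_prod_def atLeast0LessThan)

lemma GRL_tail_linear:
  assumes "A \<in> carrier_mat 3 3" "j < 3"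
  shows "GRL_tail k A (f + g) j = GRL_tail k A f j + GRL_tail k A g j"
    and "GRL_tail k A (Polynomial.smult c f) j = c * GRL_tail k A f j"
    and "GRL_tail k A (f - g) j = GRL_tail k A f j - GRL_tail k A g j"
  using assms by (simp_all add: GRL_tail_sum sum.distrib sum_subtractf sum_distrib_left algebra_simps)

lemma GRL_word_linear:
  assumes "A \<in> carrier_mat 3 3"
  shows "GRL_word k 3 a v A (f + g) = GRL_word k 3 a v A f + GRL_word k 3 a v A g"
    and "GRL_word k 3 a v A (Polynomial.smult c f) = c \<cdot>\<^sub>v GRL_word k 3 a v A f"
proof -
  have *: "i < dim_vec a \<or> (\<exists>j<3. i = dim_vec a + j)" if "i < dim_vec a + 3" for i
    using that by (metis add_less_cancel_left less_eqE not_less)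
  have dim: "dim_vec (GRL_word k 3 a v A f) = dim_vec a + 3" for f by (simp add: GRL_word_def)
  show "GRL_word k 3 a v A (f + g) = GRL_word k 3 a v A f + GRL_word k 3 a v A g"
  proof (rule eq_vecI)
    fix i assume "i < dim_vec (GRL_word k 3 a v A f + GRL_word k 3 a v A g)"
    then have i: "i < dim_vec a + 3" by (simp add: dim)
    with *[OF i] show "GRL_word k 3 a v A (f + g) $ i = (GRL_word k 3 a v A f + GRL_word k 3 a v A g) $ i"
      by (auto simp: dim GRL_word_index GRL_tail_linear[OF assms] distrib_left)
  qed (simp add: dim)
  show "GRL_word k 3 a v A (Polynomial.smult c f) = c \<cdot>\<^sub>v GRL_word k 3 a v A f"
  proof (rule eq_vecI)
    fix i assume "i < dim_vec (c \<cdot>\<^sub>v GRL_word k 3 a v A f)"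
    then have i: "i < dim_vec a + 3" by (simp add: dim)
    with *[OF i] show "GRL_word k 3 a v A (Polynomial.smult c f) $ i = (c \<cdot>\<^sub>v GRL_word k 3 a v A f) $ i"
      by (auto simp: dim GRL_word_index GRL_tail_linear[OF assms])
  qed (simp add: dim)
qed

lemma invertible_matE:
  fixes A :: "'a::field mat"
  assumes "A \<in> carrier_mat m m" "invertible_mat A"
  obtains B where "B \<in> carrier_mat m m" "A * B = 1\<^sub>m m" "B * A = 1\<^sub>m m"
proof -
  obtain B where B: "A * B = 1\<^sub>m (dim_row A)" "B * A = 1\<^sub>m (dim_row B)"
    using assms(2) by (auto simp: invertible_mat_def inverts_mat_def)
  have "dim_col B = m" using arg_cong[OF B(1), of dim_col] assms(1) by simp
  moreover have "dim_row B = m" using arg_cong[OF B(2), of dim_col] assms(1) by simp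
  ultimately show thesis using that B assms(1) by (metis carrier_matD(1) carrier_matI)
qed

text \<open>Row \<open>j\<close> of the inverse of \<open>A\<close>, used as leading coefficients,
  produces the \<open>j\<close>-th unit vector as tail.\<close>

lemma GRL_tail_surj:
  fixes A :: "'a::field mat"
  assumes A: "A \<in> carrier_mat 3 3" "invertible_mat A" and k: "3 \<le> k" and j: "j < 3"
  shows "\<exists>f. Polynomial.degree f < k \<and> (\<forall>i<3. GRL_tail k A f i = (if i = j then 1 else 0))"
proof -
  obtain B where B: "B \<in> carrier_mat 3 3" "B * A = 1\<^sub>m 3" using invertible_matE[OF A] by metis
  define f where "f = (\<Sum>i<3. Polynomial.monom (B $$ (j, i)) (k - 3 + i))"
  have c: "Polynomial.coeff f (k - 3 + i) = B $$ (j, i)" if "i < 3" for i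
    using that by (simp add: f_def coeff_sum)
  have "GRL_tail k A f i = (B * A) $$ (j, i)" if "i < 3" for i
    using A(1) B(1) that j by (simp add: GRL_tail_sum c scalar_prod_def atLeast0LessThan)
  moreover have "Polynomial.degree f < k"
    using k by (intro degree_lessI) (auto simp: f_def coeff_sum intro!: sum.neutral)
  ultimately show ?thesis using B j by auto
qed

text \<open>The tail is the image of the coefficient vector under the transpose of \<open>A\<close>,
  which the transposed inverse undoes.\<close>

lemma GRL_tail_eq_0_imp_coeff:
  fixes A :: "'a::field mat"
  assumes A: "A \<in> carrier_mat 3 3" "invertible_mat A" and tail: "\<And>j. j < 3 \<Longrightarrow> GRL_tail k A f j = 0"
    and i: "i < 3"
  shows "Polynomial.coeff f (k - 3 + i) = 0"
proof -
  obtain B where B: "B \<in> carrier_mat 3 3" "A * B = 1\<^sub>m 3" using invertible_matE[OF A] by metis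
  let ?u = "vec 3 (\<lambda>i. Polynomial.coeff f (k - 3 + i))"
  have "A\<^sup>T *\<^sub>v ?u = 0\<^sub>v 3"
    using tail A by (intro eq_vecI) (auto simp: GRL_tail_def comm_scalar_prod[of _ 3])
  moreover have "B\<^sup>T * A\<^sup>T = 1\<^sub>m 3"
    using B A by (metis transpose_mult transpose_one)
  moreover have "(B\<^sup>T * A\<^sup>T) *\<^sub>v ?u = B\<^sup>T *\<^sub>v (A\<^sup>T *\<^sub>v ?u)"
    using A B by (intro assoc_mult_mat_vec[of _ 3 3 _ 3]) auto
  ultimately have "?u = B\<^sup>T *\<^sub>v 0\<^sub>v 3" by simp
  also have "\<dots> = 0\<^sub>v 3" using B by (intro eq_vecI) auto
  finally have "?u $ i = (0\<^sub>v 3) $ i" by simp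
  then show ?thesis using i by simp
qed

lemma GRL_tail_eq_0:
  assumes "A \<in> carrier_mat 3 3" "j < 3" "Polynomial.degree f < k - 3"
  shows "GRL_tail k A f j = 0"
  using assms by (simp add: GRL_tail_sum coeff_eq_0)

lemma galois_inner_GRL_word:
  assumes "dim_vec v = dim_vec a"
  shows "galois_inner p l (GRL_word k 3 a v A f) (GRL_word k 3 a v A g) =
    (\<Sum>i<dim_vec a. v $ i ^ (p ^ l + 1) * poly (f * g ^ p ^ l) (a $ i)) +
    (\<Sum>j<3. GRL_tail k A f j * GRL_tail k A g j ^ p ^ l)"
proof -
  have dim: "dim_vec (GRL_word k 3 a v A f) = dim_vec a + 3" by (simp add: GRL_word_def)
  have "{..<dim_vec a + 3} = {..<dim_vec a} \<union> (\<lambda>j. dim_vec a + j) ` {..<3}"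
    by (auto simp: image_iff) (metis add_less_cancel_left lessThan_iff less_eqE not_less)
  then have "galois_inner p l (GRL_word k 3 a v A f) (GRL_word k 3 a v A g) =
    (\<Sum>i<dim_vec a. GRL_word k 3 a v A f $ i * (GRL_word k 3 a v A g $ i) ^ p ^ l) +
    (\<Sum>i\<in>(\<lambda>j. dim_vec a + j) ` {..<3}. GRL_word k 3 a v A f $ i * (GRL_word k 3 a v A g $ i) ^ p ^ l)"
    unfolding galois_inner_def dim by (simp only:) (rule sum.union_disjoint, auto)
  also have "(\<Sum>i\<in>(\<lambda>j. dim_vec a + j) ` {..<3}. GRL_word k 3 a v A f $ i * (GRL_word k 3 a v A g $ i) ^ p ^ l)
    = (\<Sum>j<3. GRL_tail k A f j * GRL_tail k A g j ^ p ^ l)"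
    by (subst sum.reindex) (auto simp: GRL_word_index)
  also have "(\<Sum>i<dim_vec a. GRL_word k 3 a v A f $ i * (GRL_word k 3 a v A g $ i) ^ p ^ l) =
    (\<Sum>i<dim_vec a. v $ i ^ (p ^ l + 1) * poly (f * g ^ p ^ l) (a $ i))"
    by (intro sum.cong) (auto simp: GRL_word_index power_mult_distrib mult_ac)
  finally show ?thesis .
qed

lemma prod_linear_dvd:
  fixes g :: "'a::field poly"
  assumes "finite Z" "\<And>z. z \<in> Z \<Longrightarrow> poly g z = 0"
  shows "(\<Prod>z\<in>Z. [:- z, 1:]) dvd g"
  using assms
proof (induction Z arbitrary: g rule: finite_induct)
  case (insert x Z)
  then obtain q where q: "g = [:- x, 1:] * q" by (metis insertI1 poly_eq_0_iff_dvd dvdE)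
  have "poly q z = 0" if "z \<in> Z" for z
    using insert.prems[of z] insert.hyps that by (auto simp: q)
  then have "(\<Prod>z\<in>Z. [:- z, 1:]) dvd q" by (rule insert.IH)
  then show ?case unfolding q prod.insert[OF insert.hyps(1,2)] by (intro mult_dvd_mono) auto
qed simp

lemma GRL_word_eq_0_imp:
  assumes "GRL_params k 3 a v A" "Polynomial.degree f < k" "GRL_word k 3 a v A f = 0\<^sub>v (dim_vec a + 3)"
  shows "f = 0"
proof (rule poly_eqI_degree[of "set (list_of_vec a)"])
  have v: "v $ i \<noteq> 0" if "i < dim_vec a" for i using assms(1) that by (auto simp: GRL_params_def)
  fix x assume "x \<in> set (list_of_vec a)"
  then obtain i where i: "i < dim_vec a" "x = a $ i"
    by (auto simp: in_set_conv_nth list_of_vec_index)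
  then have "v $ i * poly f x = 0" using GRL_word_index(1)[OF i(1), of k 3 v A f] assms(3) by simp
  then show "poly f x = poly 0 x" using v i by simp
next
  have "card (set (list_of_vec a)) = dim_vec a"
    using assms(1) by (simp add: GRL_params_def distinct_card)
  then show "card (set (list_of_vec a)) > Polynomial.degree f"
    "card (set (list_of_vec a)) > Polynomial.degree (0 :: 'a poly)"
    using assms by (auto simp: GRL_params_def)
qed

lemma degree_less_iff_coeff: "k > 0 \<Longrightarrow> Polynomial.degree f < k \<longleftrightarrow> (\<forall>i\<ge>k. Polynomial.coeff f i = 0)"
  by (auto intro: degree_lessI simp: coeff_eq_0)

lemma GRL_code_linear:
  assumes "GRL_params k 3 a v A"
  shows "linear_code (dim_vec a + 3) (GRL_code k 3 a v A)"
    and "code_dim (dim_vec a + 3) (GRL_code k 3 a v A) = k"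
proof -
  have k: "k > 0" and A: "A \<in> carrier_mat 3 3" using assms by (auto simp: GRL_params_def)
  have C: "GRL_code k 3 a v A = GRL_word k 3 a v A ` {f. \<forall>i\<ge>k. Polynomial.coeff f i = 0}"
    unfolding GRL_code_def degree_less_iff_coeff[OF k] by blast
  have "f = 0" if "\<forall>i\<ge>k. Polynomial.coeff f i = 0" "GRL_word k 3 a v A f = 0\<^sub>v (dim_vec a + 3)" for f
    using GRL_word_eq_0_imp[OF assms] that degree_less_iff_coeff[OF k] by blast
  note * = code_dim_image_poly[of "GRL_word k 3 a v A", OF GRL_word_carrier GRL_word_linear[OF A] this]
  show "linear_code (dim_vec a + 3) (GRL_code k 3 a v A)"
    unfolding C by (rule *)
  show "code_dim (dim_vec a + 3) (GRL_code k 3 a v A) = k"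
    unfolding C by (rule *)
qed

text \<open>The hull consists of the words of the polynomials of degree less than \<open>k - 3\<close> that vanish on \<open>Z\<close>.\<close>

lemma code_dim_galois_hull_GRL:
  fixes a v :: "'a::field vec"
  assumes par: "GRL_params k 3 a v A" and Z: "finite Z" "card Z + h + 3 = k" and p: "p > 0"
    and c: "\<And>z. z \<in> Z \<Longrightarrow> c z \<noteq> 0"
    and form: "\<And>f g. Polynomial.degree f < k \<Longrightarrow> Polynomial.degree g < k \<Longrightarrow>
      (\<Sum>i<dim_vec a. v $ i ^ (p ^ l + 1) * poly (f * g ^ p ^ l) (a $ i)) = (\<Sum>z\<in>Z. c z * poly (f * g ^ p ^ l) z)"
  shows "code_dim (dim_vec a + 3) (galois_hull p l (dim_vec a + 3) (GRL_code k 3 a v A)) = h"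
proof -
  define N where "N = dim_vec a + 3"
  define \<psi> where "\<psi> = GRL_word k 3 a v A"
  define R where "R = (\<Prod>z\<in>Z. [:- z, 1:] :: 'a poly)"
  have A: "A \<in> carrier_mat 3 3" "invertible_mat A" and k: "k \<ge> 3" and dim: "dim_vec v = dim_vec a"
    using par by (auto simp: GRL_params_def)
  have R0: "R \<noteq> 0" using Z by (auto simp: R_def)
  have degR: "Polynomial.degree R = card Z" using Z by (simp add: R_def degree_prod_linear)
  have polyR: "poly R z = 0" if "z \<in> Z" for z using that Z by (auto simp: R_def poly_prod)
  have pl: "p ^ l > 0" using p by simp
  have inner: "galois_inner p l (\<psi> f) (\<psi> g) = (\<Sum>z\<in>Z. c z * poly f z * poly g z ^ p ^ l) +
      (\<Sum>j<3. GRL_tail k A f j * GRL_tail k A g j ^ p ^ l)"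
    if "Polynomial.degree f < k" "Polynomial.degree g < k" for f g
    unfolding \<psi>_def galois_inner_GRL_word[OF dim] form[OF that] by (simp add: mult.assoc)
  have hull: "galois_hull p l N (GRL_code k 3 a v A) =
      {\<psi> g | g. Polynomial.degree g < k \<and> (\<forall>f. Polynomial.degree f < k \<longrightarrow> galois_inner p l (\<psi> f) (\<psi> g) = 0)}"
    unfolding galois_hull_def galois_dual_def GRL_code_def N_def
    using GRL_word_carrier[of k 3 a v A] by (auto simp flip: \<psi>_def)
  have "galois_hull p l N (GRL_code k 3 a v A) = (\<lambda>u. \<psi> (R * u)) ` {u. \<forall>i\<ge>h. Polynomial.coeff u i = 0}"
  proof (intro equalityI subsetI)
    fix x assume "x \<in> galois_hull p l N (GRL_code k 3 a v A)"
    then obtain g where g: "x = \<psi> g" "Polynomial.degree g < k"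
      and orth: "\<And>f. Polynomial.degree f < k \<Longrightarrow> galois_inner p l (\<psi> f) (\<psi> g) = 0"
      unfolding hull by blast
    have gZ: "poly g z = 0" if z: "z \<in> Z" for z
    proof -
      \<comment> \<open>The test polynomial isolates the term at \<open>z\<close>: it vanishes on
        the rest of \<open>Z\<close>, and its degree \<open>card Z - 1 < k - 3\<close> makes its
        tail zero.\<close>
      define f where "f = (\<Prod>y\<in>Z - {z}. [:- y, 1:] :: 'a poly)"
      have "card Z > 0" using z Z by (auto simp: card_gt_0_iff)
      then have deg: "Polynomial.degree f < k - 3"
        using Z z by (simp add: f_def degree_prod_linear)
      have fz: "poly f z \<noteq> 0" using Z by (auto simp: f_def poly_prod)
      have fy: "poly f y = 0" if "y \<in> Z" "y \<noteq> z" for y using that Z by (auto simp: f_def poly_prod)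
      have "0 = (\<Sum>y\<in>Z. c y * poly f y * poly g y ^ p ^ l)"
        using orth[of f] inner[of f g] deg g GRL_tail_eq_0[OF A(1) _ deg] by simp
      also have "\<dots> = (\<Sum>y\<in>Z. if y = z then c z * poly f z * poly g z ^ p ^ l else 0)"
        using fy by (intro sum.cong) auto
      also have "\<dots> = c z * poly f z * poly g z ^ p ^ l" using Z z by simp
      finally show ?thesis using fz c[OF z] by simp
    qed
    have tail: "GRL_tail k A g j = 0" if j: "j < 3" for j
    proof -
      \<comment> \<open>Since \<open>g\<close> vanishes on \<open>Z\<close>, the first sum is gone,
        and a test polynomial with a unit vector as tail isolates one tail coordinate of
        \<open>g\<close>.\<close>
      obtain f where f: "Polynomial.degree f < k" "\<forall>i<3. GRL_tail k A f i = (if i = j then 1 else 0)"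
        using GRL_tail_surj[OF A k j] by blast
      have "0 = (\<Sum>i<3. GRL_tail k A f i * GRL_tail k A g i ^ p ^ l)"
        using orth[OF f(1)] inner[OF f(1) g(2)] gZ pl by (simp add: zero_power)
      also have "\<dots> = (\<Sum>i<3. if i = j then GRL_tail k A g j ^ p ^ l else 0)"
        using f(2) by (intro sum.cong) auto
      also have "\<dots> = GRL_tail k A g j ^ p ^ l" using j by simp
      finally show ?thesis by simp
    qed
    obtain u where u: "g = R * u" using prod_linear_dvd[OF Z(1) gZ] by (auto simp: R_def)
    have "Polynomial.coeff u i = 0" if "i \<ge> h" for i
    proof (cases "u = 0")
      case False
      have top: "Polynomial.coeff g i = 0" if "i \<ge> k - 3" for i
      proof (cases "i < k")
        case True
        then show ?thesis using GRL_tail_eq_0_imp_coeff[OF A tail, of "i - (k - 3)"] that by simp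
      qed (use g(2) in \<open>simp add: coeff_eq_0\<close>)
      have "g \<noteq> 0" using R0 False by (simp add: u)
      then have "Polynomial.degree g < k - 3" using top by (meson leading_coeff_0_iff not_less)
      moreover have "Polynomial.degree g = card Z + Polynomial.degree u"
        using R0 False degR by (simp add: u degree_mult_eq)
      ultimately show ?thesis using Z that by (intro coeff_eq_0) simp
    qed simp
    then show "x \<in> (\<lambda>u. \<psi> (R * u)) ` {u. \<forall>i\<ge>h. Polynomial.coeff u i = 0}" using g u by blast
  next
    fix x assume "x \<in> (\<lambda>u. \<psi> (R * u)) ` {u. \<forall>i\<ge>h. Polynomial.coeff u i = 0}"
    then obtain u where x: "x = \<psi> (R * u)" and u: "\<forall>i\<ge>h. Polynomial.coeff u i = 0" by blast
    have Ru: "Polynomial.degree (R * u) < k \<and> (\<forall>j<3. GRL_tail k A (R * u) j = 0)"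
    proof (cases "u = 0")
      case True
      then show ?thesis using k A by (simp add: GRL_tail_sum)
    next
      case False
      then have "Polynomial.degree u < h" using u by (meson leading_coeff_0_iff not_less)
      then have "Polynomial.degree (R * u) < k - 3"
        using degree_mult_le[of R u] degR Z by simp
      then show ?thesis using GRL_tail_eq_0[OF A(1)] by auto
    qed
    have "galois_inner p l (\<psi> f) (\<psi> (R * u)) = 0" if "Polynomial.degree f < k" for f
    proof -
      have "(\<Sum>z\<in>Z. c z * poly f z * poly (R * u) z ^ p ^ l) = 0"
        using polyR pl by (intro sum.neutral) (simp add: zero_power)
      moreover have "(\<Sum>j<3. GRL_tail k A f j * GRL_tail k A (R * u) j ^ p ^ l) = 0"
        using Ru pl by (intro sum.neutral) (simp add: zero_power)
      ultimately show ?thesis using inner[of f "R * u"] that Ru by simp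
    qed
    then show "x \<in> galois_hull p l N (GRL_code k 3 a v A)"
      unfolding hull x using Ru by blast
  qed
  moreover have "code_dim N ((\<lambda>u. \<psi> (R * u)) ` {u. \<forall>i\<ge>h. Polynomial.coeff u i = 0}) = h"
  proof (rule code_dim_image_poly)
    show "\<psi> (R * u) \<in> carrier_vec N" for u unfolding \<psi>_def N_def by (rule GRL_word_carrier)
    show "\<psi> (R * (f + g)) = \<psi> (R * f) + \<psi> (R * g)" for f g
      unfolding \<psi>_def distrib_left by (rule GRL_word_linear[OF A(1)])
    show "\<psi> (R * Polynomial.smult c f) = c \<cdot>\<^sub>v \<psi> (R * f)" for c f
      unfolding \<psi>_def mult_smult_right by (rule GRL_word_linear[OF A(1)])
    fix f :: "'a poly" assume f: "\<forall>i\<ge>h. Polynomial.coeff f i = 0" "\<psi> (R * f) = 0\<^sub>v N"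
    show "f = 0"
    proof (rule ccontr)
      assume "f \<noteq> 0"
      then have "Polynomial.degree f < h" using f by (meson leading_coeff_0_iff not_less)
      then have "Polynomial.degree (R * f) < k" using degree_mult_le[of R f] degR Z by simp
      then have "R * f = 0"
        using f(2) unfolding \<psi>_def N_def by (rule GRL_word_eq_0_imp[OF par])
      then show False using R0 \<open>f \<noteq> 0\<close> by simp
    qed
  qed
  ultimately show ?thesis by (simp add: N_def)
qed

section \<open>Choice of the column multipliers\<close>

context galois_field begin

text \<open>This is where \<open>q > 4\<close> enters. If \<open>q - 1\<close> divided
  \<open>Q + 1\<close>, then \<open>Q * Q \<le> q \<le> Q + 2\<close> would force
  \<open>Q = 2\<close> and \<open>q = 4\<close>; in the field with four elements every nonzero cube
  is indeed \<open>1\<close>, and rescaling by \<open>w\<close> would not change the form.\<close>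

lemma w_power_Suc_Q_neq_1:
  assumes "CARD('a) > 4"
  shows "w ^ (p ^ l + 1) \<noteq> 1"
proof
  define Q where "Q = p ^ l"
  have Q: "Q \<ge> 2" using Q_gt_1 by (simp add: Q_def)
  have "e > 0" using card card_gt_1 by (auto intro!: Nat.gr0I)
  then have "2 * l \<le> e" using dvd by (simp add: dvd_imp_le)
  then have "p ^ (2 * l) \<le> p ^ e" using prime by (intro power_increasing) (auto simp: prime_gt_0_nat Suc_leI)
  then have "Q * Q \<le> CARD('a)" by (simp add: Q_def card mult_2 power_add)
  assume "w ^ (p ^ l + 1) = 1"
  then have "CARD('a) - 1 dvd Q + 1" unfolding Q_def primitive_element_power_eq_1_iff[OF prim] .
  then have le: "CARD('a) \<le> Q + 2" by (auto dest!: dvd_imp_le)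
  show False
  proof (cases "Q = 2")
    case False
    then have "3 * Q \<le> Q * Q" using Q by (intro mult_right_mono) auto
    with le \<open>Q * Q \<le> CARD('a)\<close> Q show False by linarith
  qed (use le assms in simp)
qed

text \<open>On \<open>U\<close> the weight \<open>\<mu>\<close> becomes
  \<open>\<mu> + \<delta> * \<mu>\<close>. The unchanged part sums to the terms over
  \<open>E\<close>, and the increments give further diagonal terms over \<open>U\<close>, so the
  form is supported on \<open>E \<union> U\<close>.\<close>

lemma exists_GRL_hull_dim:
  fixes a :: "'a vec" and A :: "'a mat"
  assumes q: "CARD('a) > 4" and a: "distinct (list_of_vec a)" "set (list_of_vec a) = S"
    and A: "A \<in> carrier_mat 3 3" "invertible_mat A" and k: "4 \<le> k"
    and weights: "galois_weights S E j" "0 < j" and E: "finite E" "E \<inter> S = {}"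
    and deg: "(k - 1) * (p ^ l + 1) + j \<le> dim_vec a" and h: "h + 3 + card E \<le> k"
  shows "\<exists>v. GRL_params k 3 a v A \<and>
    code_dim (dim_vec a + 3) (galois_hull p l (dim_vec a + 3) (GRL_code k 3 a v A)) = h"
proof -
  obtain \<mu> c where mu: "\<forall>s\<in>S. \<exists>y. y \<noteq> 0 \<and> y ^ (p ^ l + 1) = \<mu> s" and c: "\<forall>z\<in>E. c z \<noteq> 0"
    and sum0: "\<And>F. Polynomial.degree F + j \<le> card S \<Longrightarrow>
        (\<Sum>s\<in>S. \<mu> s * poly F s) = (\<Sum>z\<in>E. c z * poly F z)"
    using weights(1) unfolding galois_weights_def by blast
  obtain y where y: "y s \<noteq> 0" "y s ^ (p ^ l + 1) = \<mu> s" if "s \<in> S" for s using mu by metis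
  have cardS: "card S = dim_vec a" using a(2) distinct_card[OF a(1)] by simp
  have "k - 1 \<le> (k - 1) * (p ^ l + 1)" by simp
  then have kn: "k \<le> dim_vec a" using deg weights(2) k by linarith
  \<comment> \<open>The size of \<open>U\<close> is chosen so that
    \<open>card (E \<union> U) + h + 3 = k\<close>; the hypothesis on \<open>h\<close> makes the
    subtraction exact.\<close>
  then have "k - 3 - card E - h \<le> card S" using cardS by simp
  then obtain U where U: "U \<subseteq> S" "card U = k - 3 - card E - h" by (metis obtain_subset_with_card_n)
  have finS: "finite S" using a by auto
  then have finU: "finite U" using U finite_subset by blast
  define \<delta> where "\<delta> = w ^ (p ^ l + 1) - 1"
  have delta: "\<delta> \<noteq> 0" using w_power_Suc_Q_neq_1[OF q] by (simp add: \<delta>_def)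
  have w0: "w \<noteq> 0" using prim by (simp add: primitive_element_def)
  define v where "v = vec (dim_vec a) (\<lambda>i. if a $ i \<in> U then w * y (a $ i) else y (a $ i))"
  have aS: "a $ i \<in> S" if "i < dim_vec a" for i
    using a(2) that by (metis in_set_conv_nth length_list_of_vec list_of_vec_index)
  have vpow: "v $ i ^ (p ^ l + 1) = \<mu> (a $ i) + (if a $ i \<in> U then \<delta> * \<mu> (a $ i) else 0)"
    if "i < dim_vec a" for i
    using y(2)[OF aS[OF that]] that unfolding v_def \<delta>_def
    by (simp add: power_mult_distrib algebra_simps)
  have par: "GRL_params k 3 a v A"
    using k kn a A y(1) aS w0 by (auto simp: GRL_params_def v_def)
  have bij: "bij_betw (\<lambda>i. a $ i) {..<dim_vec a} S"
    unfolding bij_betw_def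
  proof
    show "inj_on (\<lambda>i. a $ i) {..<dim_vec a}"
      using a(1) by (auto simp: inj_on_def distinct_conv_nth list_of_vec_index)
    show "(\<lambda>i. a $ i) ` {..<dim_vec a} = S"
      unfolding a(2)[symmetric] by (auto simp: in_set_conv_nth list_of_vec_index)
  qed
  define c' where "c' z = (if z \<in> U then \<delta> * \<mu> z else c z)" for z
  have "code_dim (dim_vec a + 3) (galois_hull p l (dim_vec a + 3) (GRL_code k 3 a v A)) = h"
  proof (rule code_dim_galois_hull_GRL[OF par, where Z = "E \<union> U" and c = c'])
    show "finite (E \<union> U)" using E finU by simp
    have "E \<inter> U = {}" using E U by blast
    then have "card (E \<union> U) = card E + card U" using E finU by (simp add: card_Un_disjoint)
    then show "card (E \<union> U) + h + 3 = k" using U(2) h by simp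
    show "p > 0" using prime by (rule prime_gt_0_nat)
    show "c' z \<noteq> 0" if z: "z \<in> E \<union> U" for z
    proof (cases "z \<in> U")
      case True
      with U(1) have "z \<in> S" by blast
      from y[OF this] have "\<mu> z \<noteq> 0" by (metis power_not_zero)
      then show ?thesis using True delta by (simp add: c'_def)
    qed (use z c in \<open>auto simp: c'_def\<close>)
    fix f g :: "'a poly" assume fg: "Polynomial.degree f < k" "Polynomial.degree g < k"
    let ?F = "f * g ^ p ^ l"
    have "Polynomial.degree ?F \<le> Polynomial.degree f + Polynomial.degree g * p ^ l"
      by (rule order_trans[OF degree_mult_le]) (simp add: degree_power_le)
    also have "\<dots> \<le> (k - 1) + (k - 1) * p ^ l"
      using fg by (intro add_mono mult_right_mono) auto
    \<comment> \<open>The bound on \<open>k\<close> meets the form here: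
      \<open>(k - 1) * (p ^ l + 1)\<close> bounds the degree of \<open>f * g ^ p ^ l\<close>, and
      \<open>j\<close> is the slack required by the weights.\<close>
    finally have F: "Polynomial.degree ?F + j \<le> card S" using deg by (simp add: cardS algebra_simps)
    have "(\<Sum>i<dim_vec a. v $ i ^ (p ^ l + 1) * poly ?F (a $ i)) =
      (\<Sum>i<dim_vec a. (\<lambda>s. (\<mu> s + (if s \<in> U then \<delta> * \<mu> s else 0)) * poly ?F s) (a $ i))"
      using vpow by (intro sum.cong) auto
    also have "\<dots> = (\<Sum>s\<in>S. (\<mu> s + (if s \<in> U then \<delta> * \<mu> s else 0)) * poly ?F s)"
      using bij by (rule sum.reindex_bij_betw)
    also have "\<dots> = (\<Sum>s\<in>S. \<mu> s * poly ?F s) + (\<Sum>s\<in>S. if s \<in> U then \<delta> * \<mu> s * poly ?F s else 0)"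
      by (simp add: distrib_right sum.distrib if_distrib[of "\<lambda>x. x * _"] cong: if_cong)
    also have "(\<Sum>s\<in>S. if s \<in> U then \<delta> * \<mu> s * poly ?F s else 0) = (\<Sum>s\<in>U. \<delta> * \<mu> s * poly ?F s)"
      using U(1) finS by (simp add: sum.If_cases Int_absorb1 flip: sum.inter_restrict)
    also have "(\<Sum>s\<in>S. \<mu> s * poly ?F s) = (\<Sum>z\<in>E. c z * poly ?F z)" using F by (rule sum0)
    also have "\<dots> = (\<Sum>z\<in>E. c' z * poly ?F z)"
      using E(2) U(1) by (intro sum.cong) (auto simp: c'_def)
    also have "(\<Sum>s\<in>U. \<delta> * \<mu> s * poly ?F s) = (\<Sum>s\<in>U. c' s * poly ?F s)"
      by (intro sum.cong) (auto simp: c'_def)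
    finally show "(\<Sum>i<dim_vec a. v $ i ^ (p ^ l + 1) * poly ?F (a $ i)) = (\<Sum>z\<in>E \<union> U. c' z * poly ?F z)"
      using \<open>E \<inter> U = {}\<close> E(1) finU by (simp add: sum.union_disjoint)
  qed
  with par show ?thesis by blast
qed

end

section \<open>The minimum distance\<close>

definition eval_zeros :: "'a::field vec \<Rightarrow> 'a poly \<Rightarrow> nat set" where
  "eval_zeros a f = {i. i < dim_vec a \<and> poly f (a $ i) = 0}"

definition tail_zeros :: "nat \<Rightarrow> 'a::field mat \<Rightarrow> 'a poly \<Rightarrow> nat set" where
  "tail_zeros k A f = {j. j < 3 \<and> GRL_tail k A f j = 0}"

lemma card_tail_zeros_le: "card (tail_zeros k A f) \<le> 3"
proof -
  have "card (tail_zeros k A f) \<le> card {..<3 :: nat}"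
    by (intro card_mono) (auto simp: tail_zeros_def)
  then show ?thesis by simp
qed

text \<open>By linearity, the coordinates where the two words agree are the zeros of the word of
  \<open>f - g\<close>.\<close>

lemma hamming_dist_GRL_word:
  assumes A: "A \<in> carrier_mat 3 3" and v: "dim_vec v = dim_vec a" "\<And>i. i < dim_vec a \<Longrightarrow> v $ i \<noteq> 0"
  shows "hamming_dist (GRL_word k 3 a v A f) (GRL_word k 3 a v A g) +
    (card (eval_zeros a (f - g)) + card (tail_zeros k A (f - g))) = dim_vec a + 3"
proof -
  let ?n = "dim_vec a" and ?d = "f - g"
  have dim: "dim_vec (GRL_word k 3 a v A f) = ?n + 3" for f by (simp add: GRL_word_def)
  define D where "D = {i. i < ?n + 3 \<and> GRL_word k 3 a v A f $ i \<noteq> GRL_word k 3 a v A g $ i}"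
  define Y where "Y = (\<lambda>j. ?n + j) ` tail_zeros k A ?d"
  have split: "i < ?n \<or> (\<exists>j<3. i = ?n + j)" if "i < ?n + 3" for i
    using that by (metis add_less_cancel_left less_eqE not_less)
  have iN: "i \<in> eval_zeros a ?d \<longleftrightarrow> i \<notin> D" if "i < ?n" for i
    using that v(2)[OF that] by (auto simp: eval_zeros_def D_def GRL_word_index)
  have iY: "?n + j \<in> Y \<longleftrightarrow> ?n + j \<notin> D" if "j < 3" for j
    using that by (auto simp: Y_def tail_zeros_def D_def GRL_word_index GRL_tail_linear[OF A])
  have sub: "eval_zeros a ?d \<subseteq> {..<?n}" "Y \<subseteq> {?n..<?n + 3}" "D \<subseteq> {..<?n + 3}"
    by (auto simp: eval_zeros_def Y_def tail_zeros_def D_def)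
  have "{..<?n + 3} = D \<union> (eval_zeros a ?d \<union> Y)"
  proof (intro equalityI subsetI)
    fix i assume "i \<in> {..<?n + 3}"
    then show "i \<in> D \<union> (eval_zeros a ?d \<union> Y)" using split[of i] iN iY by auto
  qed (use sub in auto)
  moreover have "D \<inter> (eval_zeros a ?d \<union> Y) = {}"
  proof (rule ccontr)
    assume "D \<inter> (eval_zeros a ?d \<union> Y) \<noteq> {}"
    then obtain i where i: "i \<in> D" "i \<in> eval_zeros a ?d \<or> i \<in> Y" by blast
    then have "i < ?n + 3" using sub by auto
    from split[OF this] show False
    proof
      assume "i < ?n"
      then show False using i iN sub(2) by auto
    next
      assume "\<exists>j<3. i = ?n + j"
      then show False using i iY sub(1) by auto
    qed
  qed
  moreover have "eval_zeros a ?d \<inter> Y = {}" using sub by fastforce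
  moreover have fin: "finite D" "finite (eval_zeros a ?d)" "finite Y"
    using sub finite_subset by blast+
  ultimately have "card {..<?n + 3} = card D + (card (eval_zeros a ?d) + card Y)"
    by (metis card_Un_disjoint finite_UnI)
  moreover have "card Y = card (tail_zeros k A ?d)" by (simp add: Y_def card_image)
  moreover have "hamming_dist (GRL_word k 3 a v A f) (GRL_word k 3 a v A g) = card D"
    by (simp add: hamming_dist_def D_def dim)
  ultimately show ?thesis by simp
qed

text \<open>Distances between words are weights of differences, so the minimum comes from the
  largest number \<open>m\<close> of zero coordinates, which \<open>upper\<close> bounds and
  \<open>g\<close> attains against the word of \<open>0\<close>.\<close>

lemma min_distance_GRL_code:
  fixes a :: "'a::field vec"
  assumes par: "GRL_params k 3 a v A"
    and upper: "\<And>f. f \<noteq> 0 \<Longrightarrow> Polynomial.degree f < k \<Longrightarrow>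
      card (eval_zeros a f) + card (tail_zeros k A f) \<le> m"
    and g: "g \<noteq> 0" "Polynomial.degree g < k" "m \<le> card (eval_zeros a g) + card (tail_zeros k A g)"
  shows "min_distance (GRL_code k 3 a v A) = dim_vec a + 3 - m"
  unfolding min_distance_def
proof (rule Min_eqI)
  let ?W = "GRL_word k 3 a v A"
  let ?D = "{hamming_dist x y |x y. x \<in> GRL_code k 3 a v A \<and> y \<in> GRL_code k 3 a v A \<and> x \<noteq> y}"
  have par': "A \<in> carrier_mat 3 3" "dim_vec v = dim_vec a" "\<And>i. i < dim_vec a \<Longrightarrow> v $ i \<noteq> 0" "3 \<le> k"
    using par by (auto simp: GRL_params_def)
  note ham = hamming_dist_GRL_word[OF par'(1-3), of k]
  have "?D \<subseteq> {..dim_vec a + 3}"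
  proof
    fix d assume "d \<in> ?D"
    then obtain f f' where "d = hamming_dist (?W f) (?W f')" by (auto simp: GRL_code_def)
    then show "d \<in> {..dim_vec a + 3}" using ham[of f f'] by simp
  qed
  then show "finite ?D" by (rule finite_subset) simp
  show "dim_vec a + 3 - m \<le> y" if y: "y \<in> ?D" for y
  proof -
    obtain f f' where f: "y = hamming_dist (?W f) (?W f')" "?W f \<noteq> ?W f'"
      "Polynomial.degree f < k" "Polynomial.degree f' < k"
      using y by (auto simp: GRL_code_def)
    then have "f - f' \<noteq> 0" by auto
    moreover have "Polynomial.degree (f - f') < k" using f by (intro degree_diff_less)
    ultimately show ?thesis using upper[of "f - f'"] ham[of f f'] f(1) by linarith
  qed
  have k: "Polynomial.degree (0 :: 'a poly) < k" using par'(4) by simp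
  have "card (eval_zeros a g) + card (tail_zeros k A g) = m"
    using upper[OF g(1,2)] g(3) by simp
  then have "hamming_dist (?W g) (?W 0) = dim_vec a + 3 - m" using ham[of g 0] by simp
  moreover have "?W g \<noteq> ?W 0"
  proof
    assume eq: "?W g = ?W 0"
    have "0 \<cdot>\<^sub>v ?W 0 = 0\<^sub>v (dim_vec a + 3)" using GRL_word_carrier[of k 3 a v A 0] by auto
    then have "?W 0 = 0\<^sub>v (dim_vec a + 3)"
      using GRL_word_linear(2)[OF par'(1), of k a v 0 0] by simp
    then show False using GRL_word_eq_0_imp[OF par g(2)] g(1) eq by simp
  qed
  moreover have "?W g \<in> GRL_code k 3 a v A" "?W 0 \<in> GRL_code k 3 a v A"
    unfolding GRL_code_def using g(2) k by blast+
  ultimately show "dim_vec a + 3 - m \<in> ?D" by (metis (mono_tags, lifting) mem_Collect_eq)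
qed

section \<open>Leading coefficients of node polynomials\<close>

lemma esym2_insert:
  assumes "finite J" "x \<notin> J"
  shows "esym2 a (insert x J) = esym2 a J + a $ x * esym1 a J"
proof -
  let ?P = "\<lambda>J. {(i, j). i \<in> J \<and> j \<in> J \<and> i < j}"
  \<comment> \<open>Pairs are ordered by \<open>i < j\<close>, so a new pair is
    \<open>(i, x)\<close> or \<open>(x, i)\<close> according to the position of
    \<open>i\<close>.\<close>
  have eq: "?P (insert x J) = ?P J \<union> ((\<lambda>i. if i < x then (i, x) else (x, i)) ` J)"
    using assms(2) by (auto simp: image_iff) (metis linorder_neqE_nat)+
  have fin: "finite (?P J)" by (rule finite_subset[of _ "J \<times> J"]) (use assms(1) in auto)
  have inj: "inj_on (\<lambda>i. if i < x then (i, x) else (x, i)) J"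
    by (auto simp: inj_on_def split: if_splits)
  have "esym2 a (insert x J) = esym2 a J + (\<Sum>(i, j)\<in>(\<lambda>i. if i < x then (i, x) else (x, i)) ` J. a $ i * a $ j)"
    unfolding esym2_def eq using assms fin by (intro sum.union_disjoint) (auto split: if_splits)
  also have "(\<Sum>(i, j)\<in>(\<lambda>i. if i < x then (i, x) else (x, i)) ` J. a $ i * a $ j) = (\<Sum>i\<in>J. a $ x * a $ i)"
    using inj by (subst sum.reindex) (auto intro!: sum.cong simp: mult.commute)
  finally show ?thesis by (simp add: esym1_def sum_distrib_left)
qed

lemma coeff_linear_mult:
  "Polynomial.coeff ([:- c, 1:] * G) (Suc i) = Polynomial.coeff G i - c * Polynomial.coeff G (Suc i)"
  for G :: "'a::comm_ring_1 poly"
  by (simp add: coeff_pCons)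

text \<open>The factor \<open>x\<^sup>2\<close> keeps the indices of the three leading coefficients nonnegative for \<open>card J < 2\<close>.\<close>

lemma coeff_monom_2_node_poly:
  fixes a :: "'a::field vec"
  assumes "finite J"
  defines "P \<equiv> \<lambda>J. Polynomial.monom 1 2 * (\<Prod>i\<in>J. [:- (a $ i), 1:])"
  shows "Polynomial.coeff (P J) (card J) = esym2 a J \<and>
    Polynomial.coeff (P J) (card J + 1) = - esym1 a J \<and>
    Polynomial.coeff (P J) (card J + 2) = 1 \<and> Polynomial.coeff (P J) (card J + 3) = 0"
  using assms(1)
proof (induction J rule: finite_induct)
  case empty
  then show ?case by (simp add: P_def esym1_def esym2_def)
next
  case (insert x J)
  have P: "P (insert x J) = [:- (a $ x), 1:] * P J"
    unfolding P_def prod.insert[OF insert.hyps(1,2)] by (rule mult.left_commute)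
  have c: "card (insert x J) = Suc (card J)" using insert.hyps by simp
  \<comment> \<open>A linear factor shifts coefficients by one, so propagating the zero coefficient
    above the leading one requires the next coefficient up as well.\<close>
  have h: "Polynomial.coeff (P J) (card J + 4) = 0"
  proof -
    have "Polynomial.degree (P J) \<le> 2 + card J"
      unfolding P_def
      using insert.hyps by (intro order_trans[OF degree_mult_le]) (simp add: degree_monom_eq degree_prod_eq_sum_degree)
    then show ?thesis by (intro coeff_eq_0) simp
  qed
  have "esym1 a (insert x J) = a $ x + esym1 a J" using insert.hyps by (simp add: esym1_def)
  moreover have "Suc (card J) + 1 = Suc (card J + 1)" "Suc (card J) + 2 = Suc (card J + 2)"
    "Suc (card J) + 3 = Suc (card J + 3)" by simp_all
  ultimately show ?case
    using insert.IH h esym2_insert[OF insert.hyps, of a] unfolding P c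
    by (simp only: coeff_linear_mult) (simp add: algebra_simps eval_nat_numeral)
qed

lemma coeff_node_poly:
  fixes a :: "'a::field vec"
  assumes "finite J"
  defines "P \<equiv> \<Prod>i\<in>J. [:- (a $ i), 1:]"
  shows "Polynomial.coeff P (card J) = 1" 
    and "card J \<ge> 1 \<Longrightarrow> Polynomial.coeff P (card J - 1) = - esym1 a J"
    and "card J \<ge> 2 \<Longrightarrow> Polynomial.coeff P (card J - 2) = esym2 a J"
proof -
  have c: "Polynomial.coeff (Polynomial.monom 1 2 * P) i = (if i < 2 then 0 else Polynomial.coeff P (i - 2))" for i
    by (simp add: coeff_monom_mult)
  note * = coeff_monom_2_node_poly[OF assms(1), of a, folded P_def, unfolded c]
  show "Polynomial.coeff P (card J) = 1" using * by simp
  show "card J \<ge> 1 \<Longrightarrow> Polynomial.coeff P (card J - 1) = - esym1 a J"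
    using * by (auto simp: diff_Suc numeral_2_eq_2 split: nat.splits if_splits)
  show "card J \<ge> 2 \<Longrightarrow> Polynomial.coeff P (card J - 2) = esym2 a J" using * by simp
qed

lemma scalar_prod_3:
  "(x :: 'a::field vec) \<in> carrier_vec 3 \<Longrightarrow> y \<in> carrier_vec 3 \<Longrightarrow> x \<bullet> y = x $ 0 * y $ 0 + x $ 1 * y $ 1 + x $ 2 * y $ 2"
  by (simp add: scalar_prod_def eval_nat_numeral)

lemma sum_3: "(\<Sum>i<3. f i) = f 0 + f 1 + f (2 :: nat)" for f :: "nat \<Rightarrow> 'a::comm_monoid_add"
  by (simp add: eval_nat_numeral)

lemma omega_vec_index: "omega_vec a S $ 0 = 1" "omega_vec a S $ 1 = esym1 a S"
    "omega_vec a S $ 2 = (esym1 a S)\<^sup>2 - esym2 a S"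
  and gamma_vec_index: "gamma_vec a S $ 0 = esym2 a S" "gamma_vec a S $ 1 = - esym1 a S"
    "gamma_vec a S $ 2 = 1"
  unfolding omega_vec_def gamma_vec_def vec_of_list_index by simp_all

lemma omega_vec_carrier: "omega_vec a S \<in> carrier_vec 3"
  and gamma_vec_carrier: "gamma_vec a S \<in> carrier_vec 3"
  by (rule carrier_vecI, simp add: omega_vec_def gamma_vec_def)+

text \<open>By Vieta's formulas, \<open>gamma_vec a J\<close> lists the three leading coefficients
  of the monic polynomial with the roots indexed by \<open>J\<close>, in ascending order.\<close>

lemma GRL_tail_node_poly:
  fixes a :: "'a::field vec"
  assumes A: "A \<in> carrier_mat 3 3" "r < 3" and J: "finite J" "card J = k - 1" and k: "k \<ge> 3"
  shows "GRL_tail k A (\<Prod>i\<in>J. [:- (a $ i), 1:]) r = col A r \<bullet> gamma_vec a J"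
proof -
  have idx: "k - 3 = card J - 2" "k - 3 + 1 = card J - 1" "k - 3 + 2 = card J" "card J \<ge> 2" "card J \<ge> 1"
    using J k by auto
  have "GRL_tail k A (\<Prod>i\<in>J. [:- (a $ i), 1:]) r =
      esym2 a J * A $$ (0, r) - esym1 a J * A $$ (1, r) + A $$ (2, r)"
    unfolding GRL_tail_sum[OF A] sum_3
    using coeff_node_poly[OF J(1), of a] idx by simp
  also have "\<dots> = col A r \<bullet> gamma_vec a J"
    using A gamma_vec_carrier[of a J] gamma_vec_index[of a J]
    by (subst scalar_prod_3) (auto simp: mult.commute)
  finally show ?thesis .
qed

text \<open>As \<open>\<alpha>\<close> and \<open>\<beta>\<close> vary, these triples fill the plane
  orthogonal to \<open>omega_vec a I\<close>, whose entries are the complete homogeneous symmetric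
  functions of degrees \<open>0\<close>, \<open>1\<close> and \<open>2\<close> of the points indexed
  by \<open>I\<close>.\<close>

lemma coeff_linear_times_node_poly:
  fixes a :: "'a::field vec" and \<alpha> \<beta> :: 'a
  assumes I: "finite I" "card I = k - 2" and k: "k \<ge> 4"
  defines "f \<equiv> [:\<beta>, \<alpha>:] * (\<Prod>i\<in>I. [:- (a $ i), 1:])"
  shows "Polynomial.coeff f (k - 3) = \<alpha> * esym2 a I - \<beta> * esym1 a I"
    and "Polynomial.coeff f (k - 3 + 1) = \<beta> - \<alpha> * esym1 a I"
    and "Polynomial.coeff f (k - 3 + 2) = \<alpha>"
proof -
  let ?P = "\<Prod>i\<in>I. [:- (a $ i), 1:]"
  have f: "Polynomial.coeff f (Suc i) = \<beta> * Polynomial.coeff ?P (Suc i) + \<alpha> * Polynomial.coeff ?P i" for i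
    by (simp add: f_def)
  have idx: "k - 3 = Suc (card I - 2)" "k - 3 + 1 = Suc (card I - 1)" "k - 3 + 2 = Suc (card I)"
    "card I \<ge> 2" "card I \<ge> 1" "Suc (card I - 2) = card I - 1" "Suc (card I - 1) = card I"
    using I k by auto
  have "Polynomial.degree ?P = card I" using I(1) by (subst degree_prod_eq_sum_degree) auto
  then have "Polynomial.coeff ?P (Suc (card I)) = 0" by (intro coeff_eq_0) simp
  note c = this coeff_node_poly[OF I(1), of a] idx(4,5)
  show "Polynomial.coeff f (k - 3) = \<alpha> * esym2 a I - \<beta> * esym1 a I"
    unfolding idx(1) f unfolding idx(6) using c by simp
  show "Polynomial.coeff f (k - 3 + 1) = \<beta> - \<alpha> * esym1 a I"
    unfolding idx(2) f unfolding idx(7) using c by simp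
  show "Polynomial.coeff f (k - 3 + 2) = \<alpha>"
    unfolding idx(3) f using c by simp
qed

text \<open>A kernel vector of the transposed matrix is orthogonal to the three columns. It is read
  as a triple of leading coefficients: the columns of \<open>A\<close> give two zero tail
  coordinates, and orthogonality to \<open>omega_vec a I\<close> says that the triple comes from a
  linear multiple of the node polynomial of \<open>I\<close>.\<close>

lemma pair_det_eq_0_iff:
  fixes a :: "'a::field vec"
  assumes A: "A \<in> carrier_mat 3 3" and "r < 3" "t < 3"
  shows "pair_det a A r t I = 0 \<longleftrightarrow> (\<exists>u\<in>carrier_vec 3. u \<noteq> 0\<^sub>v 3 \<and>
    u \<bullet> col A r = 0 \<and> u \<bullet> col A t = 0 \<and> u \<bullet> omega_vec a I = 0)"
proof -
  let ?cs = "[col A r, col A t, omega_vec a I]"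
  let ?M = "mat_of_cols 3 ?cs"
  have M: "?M \<in> carrier_mat 3 3" by (rule carrier_matI) (simp_all add: numeral_3_eq_3)
  have om: "omega_vec a I \<in> carrier_vec 3" by (rule omega_vec_carrier)
  have cA: "col A s \<in> carrier_vec 3" for s using A by (intro carrier_vecI) simp
  have cs: "col ?M i = ?cs ! i" if "i < 3" for i
    using cA om that by (intro col_mat_of_cols) (auto simp: less_Suc_eq eval_nat_numeral)
  have "?M\<^sup>T *\<^sub>v u = 0\<^sub>v 3 \<longleftrightarrow> u \<bullet> col A r = 0 \<and> u \<bullet> col A t = 0 \<and> u \<bullet> omega_vec a I = 0"
    if u: "u \<in> carrier_vec 3" for u
  proof -
    have "?M\<^sup>T *\<^sub>v u = 0\<^sub>v 3 \<longleftrightarrow> (\<forall>i<3. (?M\<^sup>T *\<^sub>v u) $ i = 0)"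
      using M by (auto simp: vec_eq_iff)
    also have "\<dots> \<longleftrightarrow> (\<forall>i<3. ?cs ! i \<bullet> u = 0)"
      using M cs by auto
    also have "\<dots> \<longleftrightarrow> col A r \<bullet> u = 0 \<and> col A t \<bullet> u = 0 \<and> omega_vec a I \<bullet> u = 0"
      by (auto simp: less_Suc_eq eval_nat_numeral)
    finally show ?thesis
      using comm_scalar_prod[OF cA u] comm_scalar_prod[OF om u] by simp
  qed
  moreover have "pair_det a A r t I = det ?M\<^sup>T" using M by (simp add: pair_det_def det_transpose)
  moreover have "?M\<^sup>T \<in> carrier_mat 3 3" using M by simp
  ultimately show ?thesis using det_0_iff_vec_prod_zero_field[of "?M\<^sup>T" 3] by metis
qed

lemma inj_on_index: "distinct (list_of_vec a) \<Longrightarrow> inj_on (\<lambda>i. a $ i) {..<dim_vec a}"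
  by (auto simp: inj_on_def distinct_conv_nth list_of_vec_index)

lemma eval_zeros_factor:
  fixes a :: "'a::field vec"
  assumes "distinct (list_of_vec a)" "f \<noteq> 0"
  obtains q where "f = q * (\<Prod>i\<in>eval_zeros a f. [:- (a $ i), 1:])" "q \<noteq> 0"
    "Polynomial.degree f = Polynomial.degree q + card (eval_zeros a f)"
proof -
  let ?J = "eval_zeros a f"
  have J: "?J \<subseteq> {..<dim_vec a}" by (auto simp: eval_zeros_def)
  then have fin: "finite ?J" by (rule finite_subset) simp
  have inj: "inj_on (\<lambda>i. a $ i) ?J" using inj_on_index[OF assms(1)] J by (rule inj_on_subset)
  have "(\<Prod>z\<in>(\<lambda>i. a $ i) ` ?J. [:- z, 1:]) dvd f"
    using fin by (intro prod_linear_dvd) (auto simp: eval_zeros_def)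
  then have "(\<Prod>i\<in>?J. [:- (a $ i), 1:]) dvd f" using inj by (simp add: prod.reindex)
  then obtain q where q: "f = q * (\<Prod>i\<in>?J. [:- (a $ i), 1:])" by (metis dvdE mult.commute)
  moreover from this assms(2) have "q \<noteq> 0" by auto
  moreover have "Polynomial.degree (\<Prod>i\<in>?J. [:- (a $ i), 1:]) = card ?J"
    by (subst degree_prod_eq_sum_degree) auto
  moreover have "(\<Prod>i\<in>?J. [:- (a $ i), 1:]) \<noteq> 0" using q assms(2) by auto
  ultimately show thesis using that by (metis degree_mult_eq)
qed

section \<open>Zero counts and the distance conditions\<close>

context
  fixes a v :: "'a::field vec" and A :: "'a mat" and k :: nat
  assumes par: "GRL_params k 3 a v A" and k4: "4 \<le> k"
begin

lemma GRL_params_facts: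
  "A \<in> carrier_mat 3 3" "invertible_mat A" "distinct (list_of_vec a)" "k \<le> dim_vec a"
  using par by (auto simp: GRL_params_def)

lemma card_eval_zeros_le:
  assumes "f \<noteq> 0" "Polynomial.degree f < k"
  shows "card (eval_zeros a f) \<le> k - 1"
proof -
  obtain q :: "'a poly" where "Polynomial.degree f = Polynomial.degree q + card (eval_zeros a f)"
    using eval_zeros_factor[OF GRL_params_facts(3) assms(1)] by blast
  then show ?thesis using assms(2) by simp
qed

text \<open>A zero tail lowers the degree below \<open>k - 3\<close>, so at most
  \<open>k - 4\<close> roots remain, and such words never exceed \<open>k - 1\<close> zero
  coordinates in total.\<close>

lemma card_eval_zeros_le_if_tail_zero:
  assumes "f \<noteq> 0" "Polynomial.degree f < k" "card (tail_zeros k A f) = 3"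
  shows "card (eval_zeros a f) + 4 \<le> k"
proof -
  have "tail_zeros k A f = {..<3}"
    using assms(3) by (intro card_seteq) (auto simp: tail_zeros_def)
  then have tail: "GRL_tail k A f j = 0" if "j < 3" for j using that by (auto simp: tail_zeros_def)
  have "Polynomial.coeff f i = 0" if "i \<ge> k - 3" for i
  proof (cases "i < k")
    case True
    then show ?thesis
      using GRL_tail_eq_0_imp_coeff[OF GRL_params_facts(1,2) tail, of "i - (k - 3)"] that by simp
  qed (use assms(2) in \<open>simp add: coeff_eq_0\<close>)
  then have "Polynomial.degree f < k - 3" using assms(1) by (meson leading_coeff_0_iff not_less)
  moreover obtain q :: "'a poly" where "Polynomial.degree f = Polynomial.degree q + card (eval_zeros a f)"
    using eval_zeros_factor[OF GRL_params_facts(3) assms(1)] by blast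
  ultimately show ?thesis using k4 by simp
qed

text \<open>With \<open>k - 1\<close> roots the cofactor is a nonzero constant, so the tail is a
  nonzero multiple of the values tested by \<open>cond_M2\<close> and
  \<open>cond_N2\<close>.\<close>

lemma tail_zeros_if_k_minus_1_zeros:
  assumes "f \<noteq> 0" "Polynomial.degree f < k" "card (eval_zeros a f) = k - 1"
  shows "eval_zeros a f \<in> index_sets a (k - 1)"
    and "tail_zeros k A f = {r. r < 3 \<and> col A r \<bullet> gamma_vec a (eval_zeros a f) = 0}"
proof -
  let ?J = "eval_zeros a f"
  show "?J \<in> index_sets a (k - 1)" using assms(3) by (auto simp: index_sets_def eval_zeros_def)
  obtain q where q: "f = q * (\<Prod>i\<in>?J. [:- (a $ i), 1:])" "q \<noteq> 0"
    "Polynomial.degree f = Polynomial.degree q + card ?J"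
    using eval_zeros_factor[OF GRL_params_facts(3) assms(1)] .
  then have "Polynomial.degree q = 0" using assms(2,3) by simp
  then obtain c where c: "q = [:c:]" by (rule degree_eq_zeroE)
  have fin: "finite ?J" by (simp add: eval_zeros_def)
  have "GRL_tail k A f r = c * (col A r \<bullet> gamma_vec a ?J)" if "r < 3" for r
  proof -
    have "f = Polynomial.smult c (\<Prod>i\<in>?J. [:- (a $ i), 1:])" using q(1) c by simp
    then have "GRL_tail k A f r = c * GRL_tail k A (\<Prod>i\<in>?J. [:- (a $ i), 1:]) r"
      using GRL_tail_linear(2)[OF GRL_params_facts(1) that] by metis
    then show ?thesis using GRL_tail_node_poly[OF GRL_params_facts(1) that fin assms(3)] k4 by simp
  qed
  then show "tail_zeros k A f = {r. r < 3 \<and> col A r \<bullet> gamma_vec a ?J = 0}"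
    using q(2) c by (auto simp: tail_zeros_def)
qed

text \<open>The cofactor has degree at most one, so the leading triple is orthogonal to
  \<open>omega_vec\<close>; two tail zeros supply the other two orthogonality relations.\<close>

lemma pair_det_eq_0_if_k_minus_2_zeros:
  assumes "f \<noteq> 0" "Polynomial.degree f < k" "card (eval_zeros a f) = k - 2" "2 \<le> card (tail_zeros k A f)"
  shows "\<exists>I\<in>index_sets a (k - 2). \<exists>r t. r < t \<and> t < 3 \<and> pair_det a A r t I = 0"
proof -
  let ?I = "eval_zeros a f"
  have I: "?I \<in> index_sets a (k - 2)" using assms(3) by (auto simp: index_sets_def eval_zeros_def)
  have fin: "finite ?I" by (simp add: eval_zeros_def)
  have "\<not> card (tail_zeros k A f) \<le> Suc 0" using assms(4) by simp
  then obtain r t where rt: "r \<in> tail_zeros k A f" "t \<in> tail_zeros k A f" "r < t"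
    by (subst (asm) card_le_Suc0_iff_eq) (auto simp: tail_zeros_def, metis linorder_neqE_nat)
  obtain q where q: "f = q * (\<Prod>i\<in>?I. [:- (a $ i), 1:])" "q \<noteq> 0"
    "Polynomial.degree f = Polynomial.degree q + card ?I"
    using eval_zeros_factor[OF GRL_params_facts(3) assms(1)] .
  then have "Polynomial.degree q \<le> 1" using assms(2,3) k4 by simp
  then have "q = [:Polynomial.coeff q 0, Polynomial.coeff q 1:]"
    by (intro poly_eqI) (auto simp: coeff_pCons coeff_eq_0 split: nat.split)
  then obtain \<alpha> \<beta> where ab: "q = [:\<beta>, \<alpha>:]" by blast
  let ?u = "vec 3 (\<lambda>i. Polynomial.coeff f (k - 3 + i))"
  note c = coeff_linear_times_node_poly[OF fin assms(3) k4, of \<beta> \<alpha> a, folded ab, folded q(1)]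
  have "?u \<bullet> omega_vec a ?I = 0"
    by (subst scalar_prod_3) (use c in \<open>auto simp: omega_vec_carrier omega_vec_index[of a ?I, simplified]
      algebra_simps power2_eq_square\<close>)
  \<comment> \<open>The two upper entries of the triple determine \<open>\<alpha>\<close> and
    \<open>\<beta>\<close>, so a nonzero cofactor gives a nonzero triple.\<close>
  moreover have "?u \<noteq> 0\<^sub>v 3"
  proof
    assume u: "?u = 0\<^sub>v 3"
    have "\<alpha> = 0" using arg_cong[OF u, of "\<lambda>x. x $ 2"] c by simp
    moreover from this have "\<beta> = 0" using arg_cong[OF u, of "\<lambda>x. x $ 1"] c by simp
    ultimately show False using q(2) ab by simp
  qed
  ultimately have "pair_det a A r t ?I = 0"
    using rt by (subst pair_det_eq_0_iff[OF GRL_params_facts(1)])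
      (auto simp: tail_zeros_def GRL_tail_def intro!: bexI[of _ ?u])
  then show ?thesis using I rt by (auto simp: tail_zeros_def)
qed

lemma exists_k_minus_2_zeros:
  assumes I: "I \<in> index_sets a (k - 2)" and rt: "r < t" "t < 3" "pair_det a A r t I = 0"
  shows "\<exists>g. g \<noteq> 0 \<and> Polynomial.degree g < k \<and> k \<le> card (eval_zeros a g) + card (tail_zeros k A g)"
proof -
  obtain u where u: "u \<in> carrier_vec 3" "u \<noteq> 0\<^sub>v 3" "u \<bullet> col A r = 0" "u \<bullet> col A t = 0"
    "u \<bullet> omega_vec a I = 0"
    using rt pair_det_eq_0_iff[OF GRL_params_facts(1), of r t a I] by auto
  have fin: "finite I" "card I = k - 2" using I finite_subset by (auto simp: index_sets_def)
  define \<alpha> where "\<alpha> = u $ 2"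
  \<comment> \<open>\<open>\<alpha>\<close> and \<open>\<beta>\<close> are solved from the two upper
    coefficients; the lowest one then agrees with \<open>u $ 0\<close> by orthogonality to
    \<open>omega_vec a I\<close>.\<close>
  define \<beta> where "\<beta> = u $ 1 + \<alpha> * esym1 a I"
  define g where "g = [:\<beta>, \<alpha>:] * (\<Prod>i\<in>I. [:- (a $ i), 1:])"
  note c = coeff_linear_times_node_poly[OF fin k4, of \<beta> \<alpha> a, folded g_def]
  have "u $ 0 + u $ 1 * esym1 a I + u $ 2 * ((esym1 a I)\<^sup>2 - esym2 a I) = 0"
    using u(5) by (subst (asm) scalar_prod_3) (auto simp: omega_vec_carrier omega_vec_index[of a I, simplified] u(1))
  then have u0: "u $ 0 = \<alpha> * esym2 a I - \<beta> * esym1 a I"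
    by (simp add: \<alpha>_def \<beta>_def algebra_simps power2_eq_square add_eq_0_iff)
  have "vec 3 (\<lambda>i. Polynomial.coeff g (k - 3 + i)) = u"
  proof (rule eq_vecI)
    fix i assume "i < dim_vec u"
    then have "i = 0 \<or> i = 1 \<or> i = 2" using u(1) by auto
    then show "vec 3 (\<lambda>i. Polynomial.coeff g (k - 3 + i)) $ i = u $ i"
      using c u0 by (auto simp: \<alpha>_def \<beta>_def)
  qed (use u(1) in auto)
  then have tail: "{r, t} \<subseteq> tail_zeros k A g" using u rt by (auto simp: tail_zeros_def GRL_tail_def)
  have "g \<noteq> 0"
  proof
    assume "g = 0"
    with c have "\<alpha> = 0" "\<beta> = 0" by auto
    then have "u $ i = 0" if "i < 3" for i
      using u0 that by (auto simp: \<alpha>_def \<beta>_def less_Suc_eq eval_nat_numeral)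
    then show False using u(1,2) by auto
  qed
  moreover have "Polynomial.degree g < k"
  proof -
    have "Polynomial.degree g \<le> 1 + card I"
      unfolding g_def by (rule order_trans[OF degree_mult_le]) (auto simp: degree_prod_eq_sum_degree)
    then show ?thesis using fin k4 by simp
  qed
  moreover have "poly (\<Prod>i\<in>I. [:- (a $ i), 1:]) (a $ x) = 0" if "x \<in> I" for x
    using fin(1) that by (auto simp: poly_prod)
  then have "k - 2 \<le> card (eval_zeros a g)"
    unfolding fin(2)[symmetric] using I
    by (intro card_mono) (auto simp: eval_zeros_def index_sets_def g_def)
  moreover have "2 \<le> card (tail_zeros k A g)"
    using card_mono[OF _ tail] rt by (auto simp: tail_zeros_def)
  ultimately show ?thesis by (intro exI[of _ g]) auto
qed

lemma exists_k_minus_1_zeros: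
  assumes J: "J \<in> index_sets a (k - 1)"
  shows "\<exists>g. g \<noteq> 0 \<and> Polynomial.degree g < k \<and> k - 1 \<le> card (eval_zeros a g) \<and>
    (\<forall>r<3. GRL_tail k A g r = col A r \<bullet> gamma_vec a J)"
proof -
  have fin: "finite J" "card J = k - 1" using J finite_subset by (auto simp: index_sets_def)
  let ?g = "\<Prod>i\<in>J. [:- (a $ i), 1:]"
  have "?g \<noteq> 0" using fin by auto
  moreover have "Polynomial.degree ?g < k" using fin k4 by (simp add: degree_prod_eq_sum_degree)
  moreover have "k - 1 \<le> card (eval_zeros a ?g)"
    unfolding fin(2)[symmetric] using J fin(1)
    by (intro card_mono) (auto simp: eval_zeros_def index_sets_def poly_prod)
  moreover have "GRL_tail k A ?g r = col A r \<bullet> gamma_vec a J" if "r < 3" for r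
    using GRL_tail_node_poly[OF GRL_params_facts(1) that fin] k4 by simp
  ultimately show ?thesis by blast
qed

text \<open>Evaluation zeros trade off against tail zeros: \<open>k - 1\<close> of them allow no
  tail zero by \<open>cond_M2\<close>, \<open>k - 2\<close> allow one by \<open>cond_M1\<close>, and
  \<open>k - 3\<close> allow two because a zero tail leaves at most \<open>k - 4\<close>.\<close>

lemma min_distance_if_M1_M2:
  assumes "cond_M1 a k A" "cond_M2 a k A"
  shows "min_distance (GRL_code k 3 a v A) = dim_vec a + 3 - (k - 1)"
proof -
  \<comment> \<open>Any \<open>k - 1\<close> indices show that the bound is attained; they exist
    because \<open>k \<le> n\<close>.\<close>
  have "{..<k - 1} \<in> index_sets a (k - 1)" using GRL_params_facts(4) by (auto simp: index_sets_def)
  then obtain g where g: "g \<noteq> 0" "Polynomial.degree g < k" "k - 1 \<le> card (eval_zeros a g)"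
    using exists_k_minus_1_zeros by blast
  show ?thesis
  proof (rule min_distance_GRL_code[OF par _ g(1,2)])
    fix f :: "'a poly" assume f: "f \<noteq> 0" "Polynomial.degree f < k"
    consider "card (eval_zeros a f) = k - 1" | "card (eval_zeros a f) = k - 2" | "card (eval_zeros a f) + 3 \<le> k"
      using card_eval_zeros_le[OF f] k4 by linarith
    then show "card (eval_zeros a f) + card (tail_zeros k A f) \<le> k - 1"
    proof cases
      case 1
      then have "tail_zeros k A f = {}"
        using tail_zeros_if_k_minus_1_zeros[OF f] assms(2) by (auto simp: cond_M2_def)
      with 1 show ?thesis by simp
    next
      case 2
      then have "\<not> 2 \<le> card (tail_zeros k A f)"
        using pair_det_eq_0_if_k_minus_2_zeros[OF f] assms(1) by (auto simp: cond_M1_def)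
      with 2 k4 show ?thesis by simp
    next
      case 3
      then show ?thesis
        using card_eval_zeros_le_if_tail_zero[OF f] card_tail_zeros_le[of k A f] by linarith
    qed
  qed (use g(3) in simp)
qed

text \<open>Either alternative of \<open>cond_N1\<close> provides a word with at least
  \<open>k\<close> zero coordinates. \<open>cond_N2\<close> caps the words with \<open>k - 1\<close>
  evaluation zeros, and with \<open>k - 2\<close> or \<open>k - 3\<close> of them a third tail zero
  is impossible.\<close>

lemma min_distance_if_N1_N2:
  assumes "cond_N1 a k A" "cond_N2 a k A"
  shows "min_distance (GRL_code k 3 a v A) = dim_vec a + 3 - k"
proof -
  have "\<exists>g. g \<noteq> 0 \<and> Polynomial.degree g < k \<and> k \<le> card (eval_zeros a g) + card (tail_zeros k A g)"
    using assms(1) unfolding cond_N1_def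
  proof (elim disjE bexE exE conjE)
    fix J r assume "J \<in> index_sets a (k - 1)" and r: "r < 3" "col A r \<bullet> gamma_vec a J = 0"
    then obtain g where g: "g \<noteq> 0" "Polynomial.degree g < k" "k - 1 \<le> card (eval_zeros a g)"
      "\<forall>r<3. GRL_tail k A g r = col A r \<bullet> gamma_vec a J"
      using exists_k_minus_1_zeros by blast
    have "r \<in> tail_zeros k A g" using r g(4) by (simp add: tail_zeros_def)
    then have "card (tail_zeros k A g) > 0" by (auto simp: card_gt_0_iff tail_zeros_def)
    then show ?thesis using g by (intro exI[of _ g]) auto
  qed (use exists_k_minus_2_zeros in blast)
  then obtain g where g: "g \<noteq> 0" "Polynomial.degree g < k"
    "k \<le> card (eval_zeros a g) + card (tail_zeros k A g)" by blast
  show ?thesis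
  proof (rule min_distance_GRL_code[OF par _ g])
    fix f :: "'a poly" assume f: "f \<noteq> 0" "Polynomial.degree f < k"
    show "card (eval_zeros a f) + card (tail_zeros k A f) \<le> k"
    proof (cases "card (eval_zeros a f) = k - 1")
      case True
      then have "card (tail_zeros k A f) \<le> 1"
        using tail_zeros_if_k_minus_1_zeros[OF f] assms(2) by (auto simp: cond_N2_def)
      with True k4 show ?thesis by simp
    next
      case False
      then show ?thesis
        using card_eval_zeros_le[OF f] card_eval_zeros_le_if_tail_zero[OF f]
          card_tail_zeros_le[of k A f] k4 by linarith
    qed
  qed
qed

end

section \<open>The theorem\<close>

theorem theoremV5:
  fixes p e l n k h :: nat
    and w :: "'a::{field,finite}"
    and a :: "'a vec"
    and S :: "'a set"
    and A :: "'a mat"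
  assumes "prime p" and "CARD('a) = p ^ e" and "CARD('a) > 4"
    and "l > 0" and "2 * l dvd e"
    and "primitive_element w"
    and "a \<in> carrier_vec n" and "distinct (list_of_vec a)" and "set (list_of_vec a) = S"
    and "(evset_R1 p l S \<or> evset_R3 p l w S \<or> evset_R5 p l w S) \<and>
           4 \<le> k \<and> k \<le> (n + p ^ l) div (p ^ l + 1) \<and> h \<le> k - 4
       \<or> (evset_R2 p l S \<or> evset_R4 p l w S \<or> evset_R6 p l w S \<or>
          evset_R7 p e l S \<or> evset_R8 p l S \<or> evset_R10 p l S) \<and>
           4 \<le> k \<and> k \<le> (n + p ^ l - 1) div (p ^ l + 1) \<and> h \<le> k - 3
       \<or> (\<exists>m. evset_R9 p l m S \<and>
           (4 \<le> k \<and> k \<le> (n + p ^ l) div (p ^ l + 1) \<and> h \<le> k - 4 \<or>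
            4 \<le> k \<and> k \<le> (n + p ^ l - m) div (p ^ l + 1) \<and> h \<le> k - 3))"
    and "A \<in> carrier_mat 3 3" and "invertible_mat A"
  shows "(cond_M1 a k A \<and> cond_M2 a k A \<longrightarrow>
           (\<exists>C v. GRL_params k 3 a v A \<and> C = GRL_code k 3 a v A \<and>
              is_code (n + 3) k (n - k + 4) C \<and> is_MDS (n + 3) C \<and>
              code_dim (n + 3) (galois_hull p l (n + 3) C) = h)) \<and>
         (cond_N1 a k A \<and> cond_N2 a k A \<longrightarrow>
           (\<exists>C v. GRL_params k 3 a v A \<and> C = GRL_code k 3 a v A \<and>
              is_code (n + 3) k (n - k + 3) C \<and> is_AMDS (n + 3) C \<and>
              code_dim (n + 3) (galois_hull p l (n + 3) C) = h))"
proof -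
  interpret galois_field p e l w
    using assms by unfold_locales auto
  have n: "n = dim_vec a" using assms(7) by simp
  then have cardS: "n = card S" using assms(8,9) distinct_card[of "list_of_vec a"] by simp
  obtain E j where k4: "4 \<le> k" and E: "galois_weights S E j" "0 < j" "finite E" "E \<inter> S = {}"
    and deg: "(k - 1) * (p ^ l + 1) + j \<le> n" and h: "h + 3 + card E \<le> k"
    using evset_galois_weights[OF cardS assms(10)] by blast
  \<comment> \<open>\<open>v\<close> is fixed by the hull requirement before any distance condition
    is considered, so one code serves both implications.\<close>
  obtain v where par: "GRL_params k 3 a v A"
    and hull: "code_dim (n + 3) (galois_hull p l (n + 3) (GRL_code k 3 a v A)) = h"
    using exists_GRL_hull_dim[OF assms(3,8,9,11,12) k4 E deg[unfolded n] h] n by auto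
  have kn: "k \<le> n" using par n by (simp add: GRL_params_def)
  note lin = GRL_code_linear[OF par, folded n]
  have "min_distance (GRL_code k 3 a v A) = n - k + 4" if "cond_M1 a k A" "cond_M2 a k A"
    using min_distance_if_M1_M2[OF par k4 that] n kn k4 by simp
  moreover have "min_distance (GRL_code k 3 a v A) = n - k + 3" if "cond_N1 a k A" "cond_N2 a k A"
    using min_distance_if_N1_N2[OF par k4 that] n kn by simp
  ultimately show ?thesis
    using par hull lin kn unfolding is_MDS_def is_AMDS_def is_code_def
    by (intro conjI impI exI[of _ "GRL_code k 3 a v A"] exI[of _ v]) auto
qed

end
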